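(* $\mathfrak{hp}\geq\mathrm{cov}(\mathcal{A})$.
   Context: A compactification $\alpha\omega$ of the countable discrete space $\omega$ is a compact Hausdorff space containing $\omega$ as a dense subspace. $\alpha\omega\leq\gamma\omega$ means there is a continuous surjection $f:\gamma\omega\to\alpha\omega$ whose restriction to $\omega$ is the identity; $\alpha\omega\simeq\gamma\omega$ means such an $f$ can be chosen to be a homeomorphism. Modulo $\simeq$, compactifications of $\omega$ ordered by $\leq$ form a complete upper semilattice with largest element the Stone–Čech compactification $\beta\omega$; $\sup$ is taken in it. $C_{\alpha\omega}$ denotes the set of bounded functions $\omega\to\mathbb{R}$ that extend continuously over $\alpha\omega$; it determines $\alpha\omega$ up to $\simeq$, and every subring of the ring of bounded functions on $\omega$ that is closed in the uniform norm, contains all constants and generates the topology of $\omega$ is of this form. A metric $d$ on $\omega$ is proper if each $d$-bounded set has compact closure. $\mathrm{PM}(\omega)$ is the set of all proper metrics on $\omega$ compatible with the discrete topology. For $d\in\mathrm{PM}(\omega)$, a function $f:\omega\to\mathbb{R}$ is slowly oscillating with respect to $d$ if for all $r>0$ and $\varepsilon>0$ there is a compact (i.e. finite) $K\subseteq\omega$ such that $\mathrm{diam}\, f[\mathrm{B}_d(x,r)]<\varepsilon$ for all $x\in\omega\setminus K$. $C^*_d(\omega)$ is the ring of all bounded slowly oscillating functions from $(\omega,d)$ to $\mathbb{R}$, and the Higson compactification $\overline{\omega}^d$ is the compactification with $C_{\overline{\omega}^d}=C^*_d(\omega)$. $\mathrm{PM}'(\omega)$ is the set of $d\in\mathrm{PM}(\omega)$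 with $\beta\omega\not\simeq\overline{\omega}^d$. A set $D\subseteq\mathrm{PM}'(\omega)$ has the Higson finite intersection property (Higson-FIP) if for every finite $F\subseteq D$, $\beta\omega\not\simeq\sup\{\overline{\omega}^d: d\in F\}$. $\mathfrak{hp}$ is the smallest cardinality of a set $D\subseteq\mathrm{PM}'(\omega)$ with the Higson-FIP such that $\beta\omega\simeq\sup\{\overline{\omega}^d: d\in D\}$. $(2^\omega,+)$ is the group under pointwise addition modulo 2 on the Cantor space $2^\omega$. $\mathcal{A}$ is the collection of proper subgroups of $(2^\omega,+)$ which are analytic subsets of $2^\omega$ and closed under finite modifications (if $f,g\in2^\omega$ agree at all but finitely many $n$, then $f$ belongs to the subgroup iff $g$ does). $\mathrm{cov}(\mathcal{A})$ is the smallest cardinality of a subfamily $\mathcal{A}'\subseteq\mathcal{A}$ with $\bigcup\mathcal{A}'=2^\omega$. Convention: if no set of the required kind exists, the cardinal being defined is $\infty$, and $\lambda<\infty$ for every cardinal $\lambda$. *)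

theory Defs
  imports "HOL-Analysis.Analysis" "HOL-Algebra.Group"
begin

unbundle cardinal_syntax

section \<open>Compactifications of the countable discrete space\<close>

text \<open>A compactification is a space together with the map that embeds \<open>\<omega>\<close> (the type
  \<^typ>\<open>nat\<close> with the discrete topology) onto a dense subspace.\<close>

type_synonym 'a cpn = "'a topology \<times> (nat \<Rightarrow> 'a)"

definition compactification :: "'a cpn \<Rightarrow> bool" where
  "compactification K \<longleftrightarrow>
     compact_space (fst K) \<and> Hausdorff_space (fst K) \<and>
     embedding_map (discrete_topology UNIV) (fst K) (snd K) \<and>
     (fst K) closure_of (range (snd K)) = topspace (fst K)"

definition cpn_le :: "'a cpn \<Rightarrow> 'b cpn \<Rightarrow> bool"  (infix "\<le>\<^sub>c" 50) where
  "K \<le>\<^sub>c L \<longleftrightarrow>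
     (\<exists>f. continuous_map (fst L) (fst K) f \<and> f ` topspace (fst L) = topspace (fst K) \<and>
          (\<forall>n. f (snd L n) = snd K n))"

definition cpn_equiv :: "'a cpn \<Rightarrow> 'b cpn \<Rightarrow> bool"  (infix "\<simeq>\<^sub>c" 50) where
  "K \<simeq>\<^sub>c L \<longleftrightarrow>
     (\<exists>f. homeomorphic_map (fst L) (fst K) f \<and> (\<forall>n. f (snd L n) = snd K n))"

definition extendable_functions :: "'a cpn \<Rightarrow> (nat \<Rightarrow> real) set" where
  "extendable_functions K =
     {f. bounded (range f) \<and>
         (\<exists>g. continuous_map (fst K) euclideanreal g \<and> (\<forall>n. g (snd K n) = f n))}"

text \<open>To quantify over all compactifications, their points must come from one type that is large
  enough. Evaluating the functions in \<open>C\<^bsub>\<alpha>\<omega>\<^esub>\<close> embeds \<open>\<alpha>\<omega>\<close> into a power of the reals with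
  exponents among the functions from \<open>\<omega>\<close> to the reals; so every compactification, over any type
  whatsoever, is equivalent to one over the following type (lemma \<open>compactification_universe\<close>).\<close>

type_synonym univ = "(nat \<Rightarrow> real) \<Rightarrow> real"

lemma compactification_universe:
  fixes K :: "'a cpn"
  assumes "compactification K"
  shows "\<exists>L :: univ cpn. compactification L \<and> L \<simeq>\<^sub>c K"
proof -
  obtain X e where K: "K = (X, e)" by (cases K)
  have cpt: "compact_space X" and haus: "Hausdorff_space X"
    and emb: "embedding_map (discrete_topology UNIV) X e"
    and dense: "X closure_of (range e) = topspace X"
    using assms by (auto simp: compactification_def K)
  define E where "E = extendable_functions K"
  define g where "g f = (SOME g. continuous_map X euclideanreal g \<and> (\<forall>n. g (e n) = f n))" for f
  have g: "continuous_map X euclideanreal (g f) \<and> (\<forall>n. g f (e n) = f n)" if "f \<in> E" for f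
  proof -
    have "\<exists>g. continuous_map X euclideanreal g \<and> (\<forall>n. g (e n) = f n)"
      using that by (auto simp: E_def extendable_functions_def K)
    then show ?thesis unfolding g_def by (rule someI_ex)
  qed
  define F :: "'a \<Rightarrow> univ" where "F x f = (if f \<in> E then g f x else 0)" for x f
  define P where "P = product_topology (\<lambda>_::nat \<Rightarrow> real. euclideanreal) UNIV"
  define Y where "Y = subtopology P (F ` topspace X)"
  have tP: "topspace P = UNIV" by (simp add: P_def)
  have contF: "continuous_map X P F"
    unfolding P_def continuous_map_componentwise_UNIV
    using g by (auto simp: F_def)
  have contY: "continuous_map X Y F"
    unfolding Y_def using contF by (simp add: continuous_map_in_subtopology)
  have HP: "Hausdorff_space P"
    by (simp add: P_def Hausdorff_space_product_topology)
  have HY: "Hausdorff_space Y"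
    unfolding Y_def by (rule Hausdorff_space_subtopology[OF HP])
  have tY: "topspace Y = F ` topspace X" by (simp add: Y_def tP)
  have e_in: "e n \<in> topspace X" for n
    using homeomorphic_imp_surjective_map[OF emb[unfolded embedding_map_def]] by auto
  have injF: "inj_on F (topspace X)"
  proof (rule inj_onI, rule ccontr)
    fix x y assume xy: "x \<in> topspace X" "y \<in> topspace X" "F x = F y" "x \<noteq> y"
    have nX: "normal_space X"
      using cpt haus compact_Hausdorff_or_regular_imp_normal_space by blast
    have cl: "closedin X {x}" "closedin X {y}"
      using haus xy by (auto intro: closedin_Hausdorff_singleton)
    obtain h :: "'a \<Rightarrow> real" where h: "continuous_map X (top_of_set {0..1}) h" "h ` {x} \<subseteq> {0}" "h ` {y} \<subseteq> {1}"
      using Urysohn_lemma[OF nX cl, of 0 1] xy by auto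
    have hc: "continuous_map X euclideanreal h" and hb: "\<And>z. z \<in> topspace X \<Longrightarrow> h z \<in> {0..1}"
      using h(1) by (auto simp: continuous_map_in_subtopology)
    have "bounded (range (h \<circ> e))"
      using hb[OF e_in] by (intro boundedI[of _ 1]) auto
    then have hE: "h \<circ> e \<in> E"
      using hc by (auto simp: E_def extendable_functions_def K)
    have *: "g (h \<circ> e) z = h z" if "z \<in> topspace X" for z
      by (rule forall_in_closure_of_eq[where X=X and Y=euclideanreal and S="range e"])
         (use that dense hc g[OF hE] in \<open>auto simp: comp_def\<close>)
    have "F x (h \<circ> e) = F y (h \<circ> e)" using xy by simp
    then show False using *[OF xy(1)] *[OF xy(2)] hE h by (simp add: F_def)
  qed
  have hom: "homeomorphic_map X Y F"
    by (rule continuous_imp_homeomorphic_map[OF contY cpt HY]) (use tY injF in auto)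
  have "compactification (Y, F \<circ> e)"
    unfolding compactification_def fst_conv snd_conv
  proof (intro conjI)
    show "compact_space Y" using hom cpt homeomorphic_compact_space homeomorphic_map_imp_homeomorphic_space by blast
    show "Hausdorff_space Y" by fact
    show "embedding_map (discrete_topology UNIV) Y (F \<circ> e)"
      using emb hom embedding_map_compose surjective_embedding_map by blast
    have "Y closure_of (F ` range e) = F ` (X closure_of range e)"
      by (rule homeomorphic_map_closure_of[OF hom]) (use e_in in auto)
    then show "Y closure_of range (F \<circ> e) = topspace Y"
      by (simp add: dense tY image_comp)
  qed
  moreover have "(Y, F \<circ> e) \<simeq>\<^sub>c K"
    unfolding cpn_equiv_def K using hom by auto
  ultimately show ?thesis by blast
qed

text \<open>The largest element, suprema, and the compactification belonging to a ring are determined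
  only up to \<open>\<simeq>\<^sub>c\<close>; a representative is chosen.\<close>

definition stone_cech :: "univ cpn" where
  "stone_cech =
     (SOME B. compactification B \<and> (\<forall>K :: univ cpn. compactification K \<longrightarrow> K \<le>\<^sub>c B))"

definition is_cpn_sup :: "univ cpn set \<Rightarrow> univ cpn \<Rightarrow> bool" where
  "is_cpn_sup \<K> S \<longleftrightarrow>
     compactification S \<and> (\<forall>K\<in>\<K>. K \<le>\<^sub>c S) \<and>
     (\<forall>T :: univ cpn. compactification T \<and> (\<forall>K\<in>\<K>. K \<le>\<^sub>c T) \<longrightarrow> S \<le>\<^sub>c T)"

definition cpn_sup :: "univ cpn set \<Rightarrow> univ cpn" where
  "cpn_sup \<K> = (SOME S. is_cpn_sup \<K> S)"

section \<open>Higson compactifications\<close>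

definition PM :: "(nat \<Rightarrow> nat \<Rightarrow> real) set" where
  "PM = {d. Metric_space UNIV d \<and>
            Metric_space.mtopology UNIV d = discrete_topology UNIV \<and>
            (\<forall>A. Metric_space.mbounded UNIV d A \<longrightarrow>
                 compactin (discrete_topology UNIV) ((discrete_topology UNIV) closure_of A))}"

text \<open>The library's \<^const>\<open>diameter\<close> is meaningful for bounded sets only; for \<open>d \<in> PM\<close> balls are
  finite, so the sets it is applied to below are bounded.\<close>

definition slowly_oscillating :: "(nat \<Rightarrow> nat \<Rightarrow> real) \<Rightarrow> (nat \<Rightarrow> real) \<Rightarrow> bool" where
  "slowly_oscillating d f \<longleftrightarrow>
     (\<forall>r>0. \<forall>\<epsilon>>0. \<exists>K. finite K \<and>
        (\<forall>x. x \<notin> K \<longrightarrow> diameter (f ` Metric_space.mball UNIV d x r) < \<epsilon>))"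

definition higson_ring :: "(nat \<Rightarrow> nat \<Rightarrow> real) \<Rightarrow> (nat \<Rightarrow> real) set" where
  "higson_ring d = {f. bounded (range f) \<and> slowly_oscillating d f}"

definition higson :: "(nat \<Rightarrow> nat \<Rightarrow> real) \<Rightarrow> univ cpn" where
  "higson d = (SOME K. compactification K \<and> extendable_functions K = higson_ring d)"

definition PM' :: "(nat \<Rightarrow> nat \<Rightarrow> real) set" where
  "PM' = {d \<in> PM. \<not> stone_cech \<simeq>\<^sub>c higson d}"

definition higson_FIP :: "(nat \<Rightarrow> nat \<Rightarrow> real) set \<Rightarrow> bool" where
  "higson_FIP D \<longleftrightarrow>
     (\<forall>F. finite F \<and> F \<subseteq> D \<longrightarrow> \<not> stone_cech \<simeq>\<^sub>c cpn_sup (higson ` F))"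

section \<open>Analytic subgroups of the Cantor group\<close>

text \<open>The topology on \<^typ>\<open>nat \<Rightarrow> bool\<close> and \<^typ>\<open>nat \<Rightarrow> nat\<close> is the product topology over
  discrete factors. Addition modulo 2 on \<^typ>\<open>bool\<close> is exclusive or.\<close>

definition cantor_group :: "(nat \<Rightarrow> bool) monoid" where
  "cantor_group =
     \<lparr>carrier = UNIV, monoid.mult = (\<lambda>f g n. f n \<noteq> g n), one = (\<lambda>_. False)\<rparr>"

lemma group_cantor_group: "group cantor_group"
  by (rule groupI) (auto simp: cantor_group_def fun_eq_iff)

definition analytic :: "'a::topological_space set \<Rightarrow> bool" where
  "analytic A \<longleftrightarrow>
     A = {} \<or> (\<exists>h :: (nat \<Rightarrow> nat) \<Rightarrow> 'a. continuous_on UNIV h \<and> range h = A)"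

definition closed_under_finite_modifications :: "(nat \<Rightarrow> bool) set \<Rightarrow> bool" where
  "closed_under_finite_modifications H \<longleftrightarrow>
     (\<forall>f g. finite {n. f n \<noteq> g n} \<longrightarrow> (f \<in> H \<longleftrightarrow> g \<in> H))"

definition \<A> :: "(nat \<Rightarrow> bool) set set" where
  "\<A> = {H. subgroup H cantor_group \<and> H \<noteq> UNIV \<and> analytic H \<and>
            closed_under_finite_modifications H}"

section \<open>The two cardinal characteristics\<close>

text \<open>Cardinals are represented, as in the library, by well-orders of the form \<open>|S|\<close>; they are
  compared by \<open>\<le>o\<close>, also across types.\<close>

datatype 'a ecard = Cardinal "'a rel" | Infinity

fun ecard_le :: "'a ecard \<Rightarrow> 'b ecard \<Rightarrow> bool"  (infix "\<le>\<^sub>\<infinity>" 50) where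
  "Cardinal r \<le>\<^sub>\<infinity> Cardinal s \<longleftrightarrow> r \<le>o s"
| "Infinity \<le>\<^sub>\<infinity> Cardinal s \<longleftrightarrow> False"
| "x \<le>\<^sub>\<infinity> Infinity \<longleftrightarrow> True"

definition min_card :: "'a set set \<Rightarrow> 'a ecard" where
  "min_card \<S> =
     (if \<S> = {} then Infinity
      else Cardinal (SOME r. (\<exists>S\<in>\<S>. r = |S| ) \<and> (\<forall>S\<in>\<S>. r \<le>o |S| )))"

definition hp :: "(nat \<Rightarrow> nat \<Rightarrow> real) ecard" where
  "hp = min_card {D. D \<subseteq> PM' \<and> higson_FIP D \<and> stone_cech \<simeq>\<^sub>c cpn_sup (higson ` D)}"

definition cov_\<A> :: "(nat \<Rightarrow> bool) set ecard" where
  "cov_\<A> = min_card {\<A>'. \<A>' \<subseteq> \<A> \<and> \<Union>\<A>' = UNIV}"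

end

theory Submission
  imports Defs
begin

text \<open>Let \<open>D\<close> witness \<open>\<hh>\<pp>\<close>. For a finite nonempty \<open>F \<subseteq> D\<close> let \<open>H\<^sub>F\<close> be the set of all \<open>x \<in> 2\<^sup>\<omega>\<close> that
  extend continuously over the supremum of the Higson compactifications of the metrics in \<open>F\<close>.
  It is a group containing all finite modifications of its elements, and it is proper because
  otherwise that supremum would be \<open>\<beta>\<omega>\<close>. It is analytic because membership is witnessed by
  finitely many slowly oscillating functions together with moduli of slow oscillation, which range
  over a closed subset of a countable power of \<open>\<omega>\<close>. A function that extends over the supremum of
  all of \<open>D\<close> and takes only two values depends on finitely many slowly oscillating functions, so
  the \<open>H\<^sub>F\<close> cover \<open>2\<^sup>\<omega>\<close>. Finally \<open>D\<close> is infinite by the Higson-FIP, so there are at most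
  \<open>|D|\<close> many \<open>H\<^sub>F\<close>.

  Instead of the closed subring generated by a set \<open>E\<close> of bounded functions, we use the set \<open>uc E\<close> of
  all bounded functions that are uniformly continuous for the uniformity induced by \<open>E\<close>. This makes
  the Stone-Weierstrass theorem unnecessary.\<close>

section \<open>Cardinals\<close>

text \<open>Finite subsets are the ranges of lists over \<open>D\<close>. By induction there are at
  most \<open>|D|\<close> lists of each length, since products with an infinite set are absorbed,
  and a countable union of such families is no larger.\<close>

lemma card_of_Fpow_ordLeq_infinite:
  assumes "infinite D"
  shows "|Fpow D| \<le>o |D|"
proof -
  define L where "L n = {xs. set xs \<subseteq> D \<and> length xs = n}" for n
  have "|L n| \<le>o |D|" for n
  proof (induction n)
    case 0
    have "L 0 = {[]}" by (auto simp: L_def)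
    then show ?case using assms by (simp add: card_of_singl_ordLeq) (metis card_of_singl_ordLeq finite.emptyI)
  next
    case (Suc n)
    have "L (Suc n) = (\<lambda>(x, xs). x # xs) ` (D \<times> L n)"
      by (auto simp: L_def length_Suc_conv image_iff)
    then have "|L (Suc n)| \<le>o |D \<times> L n|" by (simp add: card_of_image)
    also have "|D \<times> L n| \<le>o |D|"
      by (rule card_of_Times_ordLeq_infinite_Field)
        (use assms Suc in \<open>simp_all add: Field_card_of card_of_card_order_on card_of_mono1\<close>)
    finally show ?case .
  qed
  moreover have "|UNIV :: nat set| \<le>o |D|" using assms infinite_iff_card_of_nat by blast
  ultimately have "|\<Union>n. L n| \<le>o |D|"
    by (intro card_of_UNION_ordLeq_infinite[OF assms]) auto
  moreover have "Fpow D = set ` (\<Union>n. L n)"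
    using finite_list by (fastforce simp: Fpow_def L_def image_iff)
  ultimately show ?thesis by (metis card_of_image ordLeq_transitive)
qed

text \<open>Cardinals are well-ordered, so the condition in the \<open>SOME\<close> of
  \<open>min_card\<close> is satisfiable, and the chosen cardinal belongs to an actual member of the
  family.\<close>

lemma min_card_attained:
  assumes "S \<noteq> {}"
  obtains A where "A \<in> S" "min_card S = Cardinal |A|" "\<forall>B\<in>S. |A| \<le>o |B|"
proof -
  have "\<exists>r\<in>card_of ` S. \<forall>s\<in>card_of ` S. r \<le>o s"
    by (rule exists_minim_Card_order) (use assms card_of_Card_order in auto)
  then have "\<exists>r. (\<exists>A\<in>S. r = |A| ) \<and> (\<forall>A\<in>S. r \<le>o |A| )" by blast
  from someI_ex[OF this] obtain A where A: "A \<in> S" "\<forall>B\<in>S. |A| \<le>o |B|"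
    and r: "(SOME r. (\<exists>A\<in>S. r = |A| ) \<and> (\<forall>A\<in>S. r \<le>o |A| )) = |A|" by auto
  have "min_card S = Cardinal |A|" unfolding min_card_def r using assms by simp
  with A show thesis using that by blast
qed

section \<open>Analytic sets\<close>

text \<open>Fixing the first \<open>n\<close> entries defines an open set in the product of discrete
  spaces, so \<open>f\<close> is locally constant.\<close>

lemma continuous_on_finite_dependence:
  fixes f :: "(nat \<Rightarrow> nat) \<Rightarrow> 'b::topological_space"
  assumes "\<And>z z'. (\<And>k. k < n \<Longrightarrow> z k = z' k) \<Longrightarrow> f z = f z'"
  shows "continuous_on UNIV f"
proof -
  have "(f \<longlongrightarrow> f z) (at z)" for z
  proof -
    have "open {z' :: nat \<Rightarrow> nat. z' k = z k}" for k
      using open_vimage[of "{z k}" "\<lambda>z. z k"] by (simp add: vimage_def open_discrete)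
    then have "open (\<Inter>k\<in>{..<n}. {z'. z' k = z k})"
      by (intro open_INT) auto
    then have "\<forall>\<^sub>F z' in nhds z. z' \<in> (\<Inter>k\<in>{..<n}. {z'. z' k = z k})"
      by (rule eventually_nhds_in_open) auto
    then have "\<forall>\<^sub>F z' in nhds z. f z' = f z"
      by (rule eventually_mono) (rule assms, auto)
    then show ?thesis
      by (intro tendsto_eventually) (simp add: eventually_at_filter eventually_mono)
  qed
  then show ?thesis by (simp add: continuous_on_def)
qed

text \<open>The \<open>n\<close>-th step replaces the current element of \<open>C\<close> by one that also agrees with \<open>z\<close> at \<open>n\<close>,
  if this is possible without changing the first \<open>n\<close> entries.\<close>

primrec closed_approx :: "(nat \<Rightarrow> nat) set \<Rightarrow> (nat \<Rightarrow> nat) \<Rightarrow> nat \<Rightarrow> (nat \<Rightarrow> nat)" where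
  "closed_approx C z 0 = (SOME c. c \<in> C)"
| "closed_approx C z (Suc n) =
     (if \<exists>c\<in>C. (\<forall>i<n. c i = closed_approx C z n i) \<and> c n = z n
      then SOME c. c \<in> C \<and> (\<forall>i<n. c i = closed_approx C z n i) \<and> c n = z n
      else closed_approx C z n)"

declare closed_approx.simps(2) [simp del]

text \<open>The approximations stay in \<open>C\<close> and change no entry \<open>i\<close> after
  stage \<open>Suc i\<close>. Hence they converge, and the limit lies in the closed set
  \<open>C\<close>. Continuity holds because stage \<open>n\<close> reads only the first
  \<open>n\<close> entries of \<open>z\<close>.\<close>

lemma closed_imp_retract_of_Baire:
  fixes C :: "(nat \<Rightarrow> nat) set"
  assumes "closed C" "C \<noteq> {}"
  obtains \<rho> :: "(nat \<Rightarrow> nat) \<Rightarrow> nat \<Rightarrow> nat" where "continuous_on UNIV \<rho>" "range \<rho> = C"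
proof -
  let ?c = "closed_approx C"
  \<comment> \<open>The limit is read off diagonally: entry \<open>n\<close> has its final value at
    stage \<open>Suc n\<close>.\<close>
  let ?\<rho> = "\<lambda>(z :: nat \<Rightarrow> nat) n. ?c z (Suc n) n"
  have step: "(\<forall>i<n. ?c z (Suc n) i = ?c z n i) \<and> (?c z n \<in> C \<longrightarrow> ?c z (Suc n) \<in> C) \<and>
      ((\<exists>c\<in>C. (\<forall>i<n. c i = ?c z n i) \<and> c n = z n) \<longrightarrow> ?c z (Suc n) n = z n)" for z n
  proof (cases "\<exists>c\<in>C. (\<forall>i<n. c i = ?c z n i) \<and> c n = z n")
    case True
    then have "\<exists>c. c \<in> C \<and> (\<forall>i<n. c i = ?c z n i) \<and> c n = z n" by blast
    from someI_ex[OF this] have "?c z (Suc n) \<in> C \<and> (\<forall>i<n. ?c z (Suc n) i = ?c z n i) \<and> ?c z (Suc n) n = z n"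
      unfolding closed_approx.simps if_P[OF True] .
    then show ?thesis by blast
  next
    case False
    then have "?c z (Suc n) = ?c z n" unfolding closed_approx.simps if_not_P[OF False] by blast
    with False show ?thesis by metis
  qed
  have inC: "?c z n \<in> C" for z n
  proof (induction n)
    case 0 show ?case using assms(2) by (simp add: some_in_eq)
  next
    case (Suc n) then show ?case using step[of n z] by blast
  qed
  have stable: "?c z n i = ?\<rho> z i" if "i < n" for z n i
    using that
  proof (induction n)
    case (Suc n)
    then show ?case using step[of n z] by (metis less_Suc_eq)
  qed simp
  have dep: "?c z n = ?c z' n" if "\<And>k. k < n \<Longrightarrow> z k = z' k" for z z' n
    using that
  proof (induction n)
    case (Suc n)
    then have "?c z n = ?c z' n" "z n = z' n" by simp_all
    then show ?case by (simp only: closed_approx.simps)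
  qed simp
  have cont: "continuous_on UNIV (\<lambda>z. ?\<rho> z n)" for n
  proof (rule continuous_on_finite_dependence[where n = "Suc n"])
    fix z z' :: "nat \<Rightarrow> nat"
    assume "\<And>k. k < Suc n \<Longrightarrow> z k = z' k"
    then show "?\<rho> z n = ?\<rho> z' n" using dep[of "Suc n" z z'] by simp
  qed
  have "?\<rho> z \<in> C" for z
  proof (rule Lim_in_closed_set[OF assms(1), where f = "?c z" and F = sequentially])
    show "\<forall>\<^sub>F n in sequentially. ?c z n \<in> C" using inC by simp
    have "\<forall>\<^sub>F n in sequentially. ?c z n i = ?\<rho> z i" for i
      using eventually_gt_at_top[of i] by (rule eventually_mono) (rule stable)
    then have "limitin euclidean (?c z) (?\<rho> z) sequentially"
      unfolding euclidean_product_topology[symmetric] limitin_componentwise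
      by (simp add: tendsto_eventually)
    then show "(?c z \<longlongrightarrow> ?\<rho> z) sequentially" by simp
  qed simp
  then have "range ?\<rho> \<subseteq> C" by blast
  \<comment> \<open>If \<open>z\<close> is in \<open>C\<close>, then \<open>z\<close> itself
    witnesses that each step can copy the next entry of \<open>z\<close>.\<close>
  moreover have "?\<rho> z = z" if "z \<in> C" for z
  proof -
    have "\<forall>i<n. ?c z n i = z i" for n
    proof (induction n)
      case (Suc n)
      then show ?case using step[of n z] that by (metis less_Suc_eq)
    qed simp
    then show ?thesis by (intro ext) blast
  qed
  then have "C \<subseteq> range ?\<rho>" by (intro subsetI image_eqI[where f = ?\<rho>] UNIV_I) (rule sym)
  ultimately have "range ?\<rho> = C" by (rule equalityI)
  moreover have "continuous_on UNIV ?\<rho>"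
    using cont by (rule continuous_on_coordinatewise_then_product)
  ultimately show thesis by (intro that[of "?\<rho>"])
qed

lemma continuous_reindex:
  "continuous_on UNIV (\<lambda>(z :: 'a \<Rightarrow> 'b::topological_space) i. z (p i))"
  by (intro continuous_on_coordinatewise_then_product continuous_on_product_coordinates)

text \<open>An enumeration of the countable index type turns \<open>C\<close> into a closed subset
  of the Baire space, which is the range of a retraction defined on the whole space. This lets codes
  be indexed by structured data instead of plain numbers.\<close>

lemma analytic_continuous_image_closed:
  fixes C :: "('i::countable \<Rightarrow> nat) set" and \<phi> :: "('i \<Rightarrow> nat) \<Rightarrow> 'a::topological_space"
  assumes C: "closed C" and \<phi>: "continuous_on UNIV \<phi>"
  shows "analytic (\<phi> ` C)"
proof (cases "C = {}")
  case True then show ?thesis by (simp add: analytic_def)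
next
  case False
  let ?p = "\<lambda>(z :: nat \<Rightarrow> nat) i. z (to_nat (i :: 'i))"
  have surj: "?p (\<lambda>n. c (from_nat n)) = c" for c by simp
  have im: "?p ` (?p -` C) = C" proof (intro equalityI subsetI)
    fix c assume "c \<in> C"
    then have "?p (\<lambda>n. c (from_nat n)) \<in> ?p ` (?p -` C)" by (intro imageI) simp
    then show "c \<in> ?p ` (?p -` C)" by (simp only: surj)
  qed auto
  have "closed (?p -` C)" by (rule closed_vimage[OF C continuous_reindex])
  moreover have "?p -` C \<noteq> {}" using False im by blast
  ultimately obtain \<rho> :: "(nat \<Rightarrow> nat) \<Rightarrow> nat \<Rightarrow> nat" where \<rho>: "continuous_on UNIV \<rho>" "range \<rho> = ?p -` C"
    by (rule closed_imp_retract_of_Baire)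
  have "continuous_on UNIV (\<lambda>z. \<phi> (?p (\<rho> z)))"
    by (intro continuous_on_compose2[OF \<phi>] continuous_on_compose2[OF continuous_reindex \<rho>(1)]) auto
  moreover have "range (\<lambda>z. \<phi> (?p (\<rho> z))) = \<phi> ` C"
  proof -
    have "range (\<lambda>z. \<phi> (?p (\<rho> z))) = \<phi> ` ?p ` range \<rho>" by (simp only: image_image)
    then show ?thesis by (simp only: \<rho>(2) im)
  qed
  ultimately show ?thesis unfolding analytic_def by (intro disjI2 exI[of _ "\<lambda>z. \<phi> (?p (\<rho> z))"] conjI) simp_all
qed

lemma analytic_UN:
  fixes A :: "nat \<Rightarrow> 'a::topological_space set"
  assumes "\<And>n. analytic (A n)"
  shows "analytic (\<Union>n. A n)"
proof (cases "(\<Union>n. A n) = {}")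
  case True then show ?thesis by (simp add: analytic_def)
next
  case False
  then obtain m where m: "A m \<noteq> {}" by blast
  \<comment> \<open>The empty set has no parametrization, so empty members are replaced by one fixed
    nonempty member.\<close>
  define B where "B n = (if A n = {} then A m else A n)" for n
  have "\<exists>h :: (nat \<Rightarrow> nat) \<Rightarrow> 'a. continuous_on UNIV h \<and> range h = B n" for n
    using assms[of n] assms[of m] m unfolding B_def analytic_def by auto
  then obtain h :: "nat \<Rightarrow> (nat \<Rightarrow> nat) \<Rightarrow> 'a"
    where h: "continuous_on UNIV (h n)" "range (h n) = B n" for n by metis
  \<comment> \<open>The first entry of \<open>z\<close> selects a member of the union, and the
    shifted sequence is the argument of its parametrization.\<close>
  let ?h = "\<lambda>z. h (z 0) (\<lambda>i. z (Suc i))"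
  have "continuous_on (\<Union>n\<in>UNIV. {z. z 0 = n}) ?h"
  proof (rule continuous_on_open_UN)
    fix n :: nat
    show "open {z :: nat \<Rightarrow> nat. z 0 = n}"
      using open_vimage[of "{n}" "\<lambda>z :: nat \<Rightarrow> nat. z 0"] by (simp add: vimage_def open_discrete)
    have "continuous_on {z. z 0 = n} (\<lambda>z. h n (\<lambda>i. z (Suc i)))"
      by (rule continuous_on_subset[OF continuous_on_compose2[OF h(1) continuous_reindex]]) auto
    then show "continuous_on {z. z 0 = n} ?h" by (rule continuous_on_eq) auto
  qed
  moreover have "(\<Union>n\<in>UNIV. {z :: nat \<Rightarrow> nat. z 0 = n}) = UNIV" by auto
  moreover have "range ?h = (\<Union>n. A n)"
  proof -
    have "range ?h = (\<Union>n. range (h n))"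
    proof (intro equalityI subsetI)
      fix y assume "y \<in> (\<Union>n. range (h n))"
      then obtain n z where "y = h n z" by blast
      then have "y = ?h (case_nat n z)" by simp
      then show "y \<in> range ?h" by blast
    qed auto
    also have "\<dots> = (\<Union>n. B n)" by (simp only: h(2))
    also have "\<dots> = (\<Union>n. A n)"
    proof (intro equalityI subsetI)
      fix y assume "y \<in> (\<Union>n. A n)"
      then obtain n where "y \<in> A n" by blast
      then have "y \<in> B n" by (auto simp: B_def)
      then show "y \<in> (\<Union>n. B n)" by blast
    qed (auto simp: B_def split: if_splits)
    finally show ?thesis .
  qed
  ultimately show ?thesis unfolding analytic_def by (intro disjI2 exI[of _ ?h] conjI) simp_all
qed

section \<open>Uniformities induced by sets of functions\<close>

definition uc :: "(nat \<Rightarrow> real) set \<Rightarrow> (nat \<Rightarrow> real) set" where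
  "uc E = {f. bounded (range f) \<and>
     (\<forall>\<epsilon>>0. \<exists>G \<delta>. finite G \<and> G \<subseteq> E \<and> \<delta> > 0 \<and>
        (\<forall>n m. (\<forall>g\<in>G. \<bar>g n - g m\<bar> < \<delta>) \<longrightarrow> \<bar>f n - f m\<bar> < \<epsilon>))}"

lemma ucI:
  assumes "bounded (range f)"
    and "\<And>\<epsilon>. \<epsilon> > 0 \<Longrightarrow> \<exists>G \<delta>. finite G \<and> G \<subseteq> E \<and> \<delta> > 0 \<and>
        (\<forall>n m. (\<forall>g\<in>G. \<bar>g n - g m\<bar> < \<delta>) \<longrightarrow> \<bar>f n - f m\<bar> < \<epsilon>)"
  shows "f \<in> uc E"
  using assms by (simp add: uc_def)

lemma ucE:
  assumes "f \<in> uc E" "\<epsilon> > 0"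
  obtains G \<delta> where "finite G" "G \<subseteq> E" "\<delta> > 0"
    "\<forall>n m. (\<forall>g\<in>G. \<bar>g n - g m\<bar> < \<delta>) \<longrightarrow> \<bar>f n - f m\<bar> < \<epsilon>"
proof -
  have "\<exists>G \<delta>. finite G \<and> G \<subseteq> E \<and> \<delta> > 0 \<and>
        (\<forall>n m. (\<forall>g\<in>G. \<bar>g n - g m\<bar> < \<delta>) \<longrightarrow> \<bar>f n - f m\<bar> < \<epsilon>)"
    using assms by (simp add: uc_def)
  then show thesis by (elim exE conjE) (rule that)
qed

lemma uc_bounded: "f \<in> uc E \<Longrightarrow> bounded (range f)"
  by (simp add: uc_def)

lemma uc_mono:
  assumes "E \<subseteq> E'"
  shows "uc E \<subseteq> uc E'"
proof
  fix f assume f: "f \<in> uc E"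
  show "f \<in> uc E'"
  proof (rule ucI[OF uc_bounded[OF f]])
    fix \<epsilon> :: real assume "\<epsilon> > 0"
    from ucE[OF f this] obtain G \<delta> where "finite G" "G \<subseteq> E" "\<delta> > 0"
      "\<forall>n m. (\<forall>g\<in>G. \<bar>g n - g m\<bar> < \<delta>) \<longrightarrow> \<bar>f n - f m\<bar> < \<epsilon>" .
    with assms show "\<exists>G \<delta>. finite G \<and> G \<subseteq> E' \<and> \<delta> > 0 \<and>
        (\<forall>n m. (\<forall>g\<in>G. \<bar>g n - g m\<bar> < \<delta>) \<longrightarrow> \<bar>f n - f m\<bar> < \<epsilon>)"
      by (intro exI[of _ G] exI[of _ \<delta>]) auto
  qed
qed

lemma subset_uc:
  assumes "\<And>f. f \<in> E \<Longrightarrow> bounded (range f)"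
  shows "E \<subseteq> uc E"
proof
  fix f assume f: "f \<in> E"
  show "f \<in> uc E"
  proof (rule ucI)
    fix \<epsilon> :: real assume "\<epsilon> > 0"
    with f show "\<exists>G \<delta>. finite G \<and> G \<subseteq> E \<and> \<delta> > 0 \<and>
        (\<forall>n m. (\<forall>g\<in>G. \<bar>g n - g m\<bar> < \<delta>) \<longrightarrow> \<bar>f n - f m\<bar> < \<epsilon>)"
      by (intro exI[of _ "{f}"] exI[of _ \<epsilon>]) auto
  qed (use f assms in blast)
qed

text \<open>Each of the finitely many functions controlling \<open>f\<close> is itself controlled by
  finitely many members of \<open>E\<close>; their union works with the smallest tolerance. Later
  arguments use this to pass through intermediate functions.\<close>

lemma uc_uc_subset: "uc (uc E) \<subseteq> uc E"
proof
  fix f assume f: "f \<in> uc (uc E)"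
  show "f \<in> uc E"
  proof (rule ucI)
    fix \<epsilon> :: real assume "\<epsilon> > 0"
    then obtain G \<delta> where G: "finite G" "G \<subseteq> uc E" "\<delta> > 0"
      "\<forall>n m. (\<forall>g\<in>G. \<bar>g n - g m\<bar> < \<delta>) \<longrightarrow> \<bar>f n - f m\<bar> < \<epsilon>"
      by (rule ucE[OF f])
    have "\<exists>H \<eta>. finite H \<and> H \<subseteq> E \<and> \<eta> > 0 \<and>
        (\<forall>n m. (\<forall>h\<in>H. \<bar>h n - h m\<bar> < \<eta>) \<longrightarrow> \<bar>g n - g m\<bar> < \<delta>)" if "g \<in> G" for g
      using that G(2,3) unfolding uc_def by auto
    then obtain H \<eta> where H: "\<And>g. g \<in> G \<Longrightarrow> finite (H g) \<and> H g \<subseteq> E \<and> \<eta> g > 0 \<and>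
        (\<forall>n m. (\<forall>h\<in>H g. \<bar>h n - h m\<bar> < \<eta> g) \<longrightarrow> \<bar>g n - g m\<bar> < \<delta>)"
      by metis
    \<comment> \<open>The inserted 1 keeps the minimum meaningful when \<open>G\<close> is
      empty.\<close>
    define \<theta> where "\<theta> = Min (insert (1::real) (\<eta> ` G))"
    have le: "\<theta> \<le> \<eta> g" if "g \<in> G" for g
      using that G(1) by (simp add: \<theta>_def)
    have "\<theta> > 0" using G(1) H by (simp add: \<theta>_def)
    moreover have "\<bar>f n - f m\<bar> < \<epsilon>" if "\<forall>h\<in>(\<Union>g\<in>G. H g). \<bar>h n - h m\<bar> < \<theta>" for n m
    proof (rule G(4)[rule_format])
      fix g assume g: "g \<in> G"
      have "\<bar>h n - h m\<bar> < \<eta> g" if "h \<in> H g" for h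
        using le[OF g] that g \<open>\<forall>h\<in>_. _\<close> by fastforce
      with H[OF g] show "\<bar>g n - g m\<bar> < \<delta>" by blast
    qed
    moreover have "finite (\<Union>g\<in>G. H g)" "(\<Union>g\<in>G. H g) \<subseteq> E" using G(1) H by (simp, blast)
    ultimately show "\<exists>G \<delta>. finite G \<and> G \<subseteq> E \<and> \<delta> > 0 \<and>
        (\<forall>n m. (\<forall>g\<in>G. \<bar>g n - g m\<bar> < \<delta>) \<longrightarrow> \<bar>f n - f m\<bar> < \<epsilon>)"
      by (intro exI[of _ "\<Union>g\<in>G. H g"] exI[of _ \<theta>] conjI) auto
  qed (use f in \<open>rule uc_bounded\<close>)
qed

definition ind :: "(nat \<Rightarrow> bool) \<Rightarrow> nat \<Rightarrow> real" where
  "ind x = (\<lambda>n. of_bool (x n))"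

lemma ind_apply [simp]: "ind x n = of_bool (x n)"
  by (simp add: ind_def)

lemma bounded_ind: "bounded (range (ind x))"
  by (intro boundedI[of _ 1]) auto

text \<open>Values in {0, 1} that differ by less than 1 are equal, so the condition for \<epsilon> =
  1 already gives all others. Membership thus rests on one finite set and one tolerance.\<close>

lemma ind_in_uc_iff:
  "ind x \<in> uc E \<longleftrightarrow> (\<exists>G \<delta>. finite G \<and> G \<subseteq> E \<and> \<delta> > 0 \<and>
     (\<forall>n m. (\<forall>g\<in>G. \<bar>g n - g m\<bar> < \<delta>) \<longrightarrow> x n = x m))" (is "_ \<longleftrightarrow> ?R")
proof
  assume "ind x \<in> uc E"
  from ucE[OF this, of 1] obtain G \<delta> where G: "finite G" "G \<subseteq> E" "\<delta> > 0"
    "\<forall>n m. (\<forall>g\<in>G. \<bar>g n - g m\<bar> < \<delta>) \<longrightarrow> \<bar>ind x n - ind x m\<bar> < 1"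
    by auto
  have "x n = x m" if "\<forall>g\<in>G. \<bar>g n - g m\<bar> < \<delta>" for n m
    using G(4)[rule_format, of n m] that by (auto simp: of_bool_def split: if_splits)
  with G(1-3) show ?R by blast
next
  assume ?R
  then obtain G \<delta> where G: "finite G" "G \<subseteq> E" "\<delta> > 0"
    "\<forall>n m. (\<forall>g\<in>G. \<bar>g n - g m\<bar> < \<delta>) \<longrightarrow> x n = x m" by blast
  show "ind x \<in> uc E"
  proof (rule ucI[OF bounded_ind])
    fix \<epsilon> :: real assume "\<epsilon> > 0"
    then have "\<bar>ind x n - ind x m\<bar> < \<epsilon>" if "\<forall>g\<in>G. \<bar>g n - g m\<bar> < \<delta>" for n m
      using that G(4) by simp
    with G(1-3) show "\<exists>G \<delta>. finite G \<and> G \<subseteq> E \<and> \<delta> > 0 \<and>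
        (\<forall>n m. (\<forall>g\<in>G. \<bar>g n - g m\<bar> < \<delta>) \<longrightarrow> \<bar>ind x n - ind x m\<bar> < \<epsilon>)" by blast
  qed
qed

text \<open>A bounded function is determined up to \<eta> by the finitely many sublevel sets at
  multiples of \<eta>, so characteristic functions control all bounded functions.\<close>

lemma bounded_in_uc_of_ind:
  assumes ind: "\<And>x. ind x \<in> uc E" and f: "bounded (range f)"
  shows "f \<in> uc E"
proof -
  have "f \<in> uc (range ind)"
  proof (rule ucI[OF f])
    fix \<epsilon> :: real assume \<epsilon>: "\<epsilon> > 0"
    obtain B where B: "\<And>n. \<bar>f n\<bar> \<le> B"
      using f by (auto simp: bounded_iff)
    define \<eta> where "\<eta> = \<epsilon> / 2"
    have \<eta>: "\<eta> > 0" "\<eta> < \<epsilon>" using \<epsilon> by (simp_all add: \<eta>_def)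
    \<comment> \<open>Every level \<open>k\<close> chosen below satisfies
      \<open>\<bar>k\<bar> \<le> B / \<eta> + 1\<close>, so the levels from \<open>-N\<close> to
      \<open>N\<close> suffice.\<close>
    define N where "N = \<lceil>B / \<eta>\<rceil> + 1"
    define H where "H k = ind (\<lambda>n. f n \<le> real_of_int k * \<eta>)" for k
    have le: "f m - f n \<le> \<eta>" if H: "\<forall>g\<in>H ` {-N..N}. \<bar>g n - g m\<bar> < 1" for n m
    proof (rule ccontr)
      assume "\<not> f m - f n \<le> \<eta>"
      \<comment> \<open>The sublevel set at the first multiple of \<eta> that is at least
        \<open>f n\<close> contains \<open>n\<close> but omits \<open>m\<close>, because
        \<open>f m\<close> exceeds \<open>f n + \<eta>\<close>.\<close>
      define k where "k = \<lceil>f n / \<eta>\<rceil>"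
      have k: "f n / \<eta> \<le> k" "k < f n / \<eta> + 1" unfolding k_def by linarith+
      have "- B / \<eta> \<le> f n / \<eta>" "f n / \<eta> \<le> B / \<eta>"
        using B[of n] \<eta>(1) by (intro divide_right_mono; linarith)+
      with k have "k \<in> {-N..N}" unfolding N_def by simp linarith
      moreover have "f n \<le> k * \<eta>" "k * \<eta> < f n + \<eta>"
        using k \<eta>(1) by (simp_all add: field_simps)
      then have "H k n = 1" "H k m = 0" using \<open>\<not> _\<close> by (simp_all add: H_def)
      ultimately show False using bspec[OF H imageI[of k]] by simp
    qed
    have "\<bar>f n - f m\<bar> < \<epsilon>" if "\<forall>g\<in>H ` {-N..N}. \<bar>g n - g m\<bar> < 1" for n m
      using le[of n m] le[of m n] that \<eta>(2) by (auto simp: abs_minus_commute)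
    then show "\<exists>G \<delta>. finite G \<and> G \<subseteq> range ind \<and> \<delta> > 0 \<and>
        (\<forall>n m. (\<forall>g\<in>G. \<bar>g n - g m\<bar> < \<delta>) \<longrightarrow> \<bar>f n - f m\<bar> < \<epsilon>)"
      by (intro exI[of _ "H ` {-N..N}"] exI[of _ 1]) (auto simp: H_def)
  qed
  also have "uc (range ind) \<subseteq> uc (uc E)"
    using ind by (intro uc_mono) auto
  also have "\<dots> \<subseteq> uc E" by (rule uc_uc_subset)
  finally show ?thesis .
qed

section \<open>Compactifications\<close>

lemma compactification_dense:
  assumes "compactification K" "p \<in> topspace (fst K)" "openin (fst K) U" "p \<in> U"
  obtains n where "snd K n \<in> U"
proof -
  have "p \<in> fst K closure_of range (snd K)"
    using assms(1,2) by (auto simp: compactification_def)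
  with assms(3,4) show thesis by (auto simp: in_closure_of intro: that)
qed

lemma compactification_range:
  assumes "compactification K"
  shows "snd K n \<in> topspace (fst K)"
proof -
  have "homeomorphic_map (discrete_topology UNIV) (subtopology (fst K) (range (snd K))) (snd K)"
    using assms by (simp add: compactification_def embedding_map_def)
  from homeomorphic_imp_surjective_map[OF this] show ?thesis by auto
qed

text \<open>Meaningful only for extendable \<open>f\<close>. Density of \<omega> makes the choice
  unique on the points of the space, though not on the rest of the type.\<close>

definition cpn_ext :: "'a cpn \<Rightarrow> (nat \<Rightarrow> real) \<Rightarrow> 'a \<Rightarrow> real" where
  "cpn_ext K f = (SOME g. continuous_map (fst K) euclideanreal g \<and> (\<forall>n. g (snd K n) = f n))"

lemma cpn_ext:
  assumes "f \<in> extendable_functions K"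
  shows "continuous_map (fst K) euclideanreal (cpn_ext K f)" "cpn_ext K f (snd K n) = f n"
proof -
  have "\<exists>g. continuous_map (fst K) euclideanreal g \<and> (\<forall>n. g (snd K n) = f n)"
    using assms by (auto simp: extendable_functions_def)
  from someI_ex[OF this] show "continuous_map (fst K) euclideanreal (cpn_ext K f)" "cpn_ext K f (snd K n) = f n"
    by (auto simp: cpn_ext_def)
qed

lemma cpn_ext_unique:
  assumes K: "compactification K" and f: "f \<in> extendable_functions K"
    and g: "continuous_map (fst K) euclideanreal g" "\<And>n. g (snd K n) = f n"
    and p: "p \<in> topspace (fst K)"
  shows "cpn_ext K f p = g p"
  by (rule forall_in_closure_of_eq[where X = "fst K" and Y = euclideanreal and S = "range (snd K)"
        and f = "cpn_ext K f"])
    (use K p g cpn_ext[OF f] in \<open>auto simp: compactification_def\<close>)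

lemma extendable_bounded: "f \<in> extendable_functions K \<Longrightarrow> bounded (range f)"
  by (simp add: extendable_functions_def)

text \<open>A compact Hausdorff space is normal. The restriction to \<omega> of a Urysohn function
  is extendable, and by density its chosen extension is the Urysohn function.\<close>

lemma compactification_Urysohn:
  assumes K: "compactification K" and p: "p \<in> topspace (fst K)"
    and C: "closedin (fst K) C" "p \<notin> C"
  obtains f where "f \<in> extendable_functions K" "cpn_ext K f p = 0" "\<And>q. q \<in> C \<Longrightarrow> cpn_ext K f q = 1"
    "\<And>n. snd K n \<in> C \<Longrightarrow> f n = 1"
proof -
  have "normal_space (fst K)" "closedin (fst K) {p}"
    using K p compact_Hausdorff_or_regular_imp_normal_space
    by (auto simp: compactification_def intro: closedin_Hausdorff_singleton)
  then obtain h :: "'a \<Rightarrow> real" where h: "continuous_map (fst K) (top_of_set {0..1}) h"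
    "h ` {p} \<subseteq> {0}" "h ` C \<subseteq> {1}"
    using Urysohn_lemma[of "fst K" "{p}" C 0 1] C by (auto simp: disjnt_def)
  have hc: "continuous_map (fst K) euclideanreal h"
    and hb: "\<And>z. z \<in> topspace (fst K) \<Longrightarrow> h z \<in> {0..1}"
    using h(1) by (auto simp: continuous_map_in_subtopology)
  have "bounded (range (h \<circ> snd K))"
    using hb[OF compactification_range[OF K]] by (intro boundedI[of _ 1]) auto
  then have f: "h \<circ> snd K \<in> extendable_functions K"
    using hc by (auto simp: extendable_functions_def)
  have "cpn_ext K (h \<circ> snd K) q = h q" if "q \<in> topspace (fst K)" for q
    by (rule cpn_ext_unique[OF K f hc _ that]) simp
  with f h C p show thesis
    by (intro that[of "h \<circ> snd K"]) (use closedin_subset[OF C(1)] in auto)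
qed

lemma extendable_separates:
  assumes K: "compactification K" and "p \<in> topspace (fst K)" "q \<in> topspace (fst K)" "p \<noteq> q"
  obtains f where "f \<in> extendable_functions K" "cpn_ext K f p \<noteq> cpn_ext K f q"
proof -
  have "closedin (fst K) {q}"
    using assms by (auto simp: compactification_def intro: closedin_Hausdorff_singleton)
  from compactification_Urysohn[OF K assms(2) this] assms(4) that show thesis
    by (metis empty_iff insert_iff zero_neq_one)
qed

text \<open>Compactness of the square of \<open>K\<close>: the set where an extension varies by at least \<open>\<epsilon>\<close> is
  covered by the sets where one of the functions in \<open>E\<close> varies by more than a positive amount.\<close>

lemma extendable_subset_uc:
  assumes K: "compactification K" and E: "E \<subseteq> extendable_functions K"
    and sep: "\<And>p q. p \<in> topspace (fst K) \<Longrightarrow> q \<in> topspace (fst K) \<Longrightarrow> p \<noteq> q \<Longrightarrow>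
      \<exists>f\<in>E. cpn_ext K f p \<noteq> cpn_ext K f q"
  shows "extendable_functions K \<subseteq> uc E"
proof
  fix f assume f: "f \<in> extendable_functions K"
  let ?X = "fst K" and ?P = "prod_topology (fst K) (fst K)"
  define V where "V g = (\<lambda>pq. \<bar>cpn_ext K g (fst pq) - cpn_ext K g (snd pq)\<bar>)" for g
  have contV: "continuous_map ?P euclideanreal (V g)" if "g \<in> extendable_functions K" for g
    unfolding V_def
    by (intro continuous_intros continuous_map_compose[OF continuous_map_fst cpn_ext(1)[OF that], unfolded comp_def]
        continuous_map_compose[OF continuous_map_snd cpn_ext(1)[OF that], unfolded comp_def])
  show "f \<in> uc E"
  proof (rule ucI[OF extendable_bounded[OF f]])
    fix \<epsilon> :: real assume \<epsilon>: "\<epsilon> > 0"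
    define Z where "Z = {pq \<in> topspace ?P. V f pq \<in> {\<epsilon>..}}"
    define U where "U = (\<lambda>(g, j). {pq \<in> topspace ?P. V g pq \<in> {1 / real (Suc j)<..}})"
    have "closedin ?P Z"
      unfolding Z_def by (rule closedin_continuous_map_preimage[OF contV[OF f]]) simp
    moreover have "compact_space ?P"
      using K by (simp add: compactification_def compact_space_prod_topology)
    ultimately have "compactin ?P Z" by (simp add: closedin_compact_space)
    moreover have "openin ?P W" if "W \<in> U ` (E \<times> UNIV)" for W
    proof -
      obtain g j where g: "g \<in> E" and W: "W = U (g, j)" using \<open>W \<in> _\<close> by blast
      show ?thesis unfolding W U_def prod.case
        by (rule openin_continuous_map_preimage[OF contV]) (use E g in auto)
    qed
    moreover have "Z \<subseteq> \<Union> (U ` (E \<times> UNIV))"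
    proof
      fix pq assume pq: "pq \<in> Z"
      have "fst pq \<noteq> snd pq" using pq \<epsilon> by (auto simp: Z_def V_def)
      then obtain g where g: "g \<in> E" "V g pq > 0"
        using sep[of "fst pq" "snd pq"] pq by (auto simp: Z_def V_def)
      obtain j where "1 / real (Suc j) < V g pq"
        using g(2) reals_Archimedean[of "V g pq"] by (auto simp: inverse_eq_divide)
      then have "pq \<in> U (g, j)" using pq by (auto simp: U_def Z_def)
      with g(1) show "pq \<in> \<Union> (U ` (E \<times> UNIV))" by blast
    qed
    ultimately obtain \<F> where \<F>: "finite \<F>" "\<F> \<subseteq> U ` (E \<times> UNIV)" "Z \<subseteq> \<Union>\<F>"
      using compactinD[of ?P Z "U ` (E \<times> UNIV)"] by blast
    then obtain I where I: "finite I" "I \<subseteq> E \<times> UNIV" "\<F> = U ` I"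
      using finite_subset_image by metis
    \<comment> \<open>The largest index in the finite subcover gives the smallest threshold; 0 is
      inserted in case the subcover is empty.\<close>
    define J where "J = Max (insert 0 (snd ` I))"
    have "\<bar>f n - f m\<bar> < \<epsilon>" if nm: "\<forall>g\<in>fst ` I. \<bar>g n - g m\<bar> < 1 / real (Suc J)" for n m
    proof (rule ccontr)
      assume "\<not> \<bar>f n - f m\<bar> < \<epsilon>"
      then have "(snd K n, snd K m) \<in> Z"
        using compactification_range[OF K] cpn_ext(2)[OF f] by (auto simp: Z_def V_def)
      then have "(snd K n, snd K m) \<in> \<Union> (U ` I)" using \<F>(3) unfolding I(3) by (rule subsetD[rotated])
      then obtain g j where gj: "(g, j) \<in> I" "(snd K n, snd K m) \<in> U (g, j)" by auto
      have gE: "g \<in> extendable_functions K" using gj(1) I(2) E by blast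
      have "1 / real (Suc j) < \<bar>g n - g m\<bar>"
        using gj(2) by (simp add: U_def V_def cpn_ext(2)[OF gE])
      moreover have "j \<le> J" unfolding J_def
        by (rule Max_ge) (use gj(1) I(1) in \<open>auto intro: image_eqI[of _ _ "(g, j)"]\<close>)
      then have "1 / real (Suc J) \<le> 1 / real (Suc j)" by (simp add: frac_le)
      moreover have "\<bar>g n - g m\<bar> < 1 / real (Suc J)" using nm gj(1) by force
      ultimately show False by linarith
    qed
    moreover have "fst ` I \<subseteq> E" using I(2) by auto
    ultimately show "\<exists>G \<delta>. finite G \<and> G \<subseteq> E \<and> \<delta> > 0 \<and>
        (\<forall>n m. (\<forall>g\<in>G. \<bar>g n - g m\<bar> < \<delta>) \<longrightarrow> \<bar>f n - f m\<bar> < \<epsilon>)"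
      using I(1) by (intro exI[of _ "fst ` I"] exI[of _ "1 / real (Suc J)"]) simp
  qed
qed

text \<open>The image is compact, hence closed, and the image of a dense set is dense in it.\<close>

lemma continuous_image_eq_closure_of:
  assumes "compact_space X" "Hausdorff_space Y" "continuous_map X Y F"
    and "X closure_of S = topspace X" "S \<subseteq> topspace X"
  shows "F ` topspace X = Y closure_of (F ` S)"
proof
  show "F ` topspace X \<subseteq> Y closure_of (F ` S)"
    using continuous_map_image_closure_subset[OF assms(3), of S] assms(4) by simp
  have "compactin Y (F ` topspace X)"
    using assms by (meson compact_space_def image_compactin)
  then have "closedin Y (F ` topspace X)"
    using assms(2) by (rule compactin_imp_closedin[rotated])
  then show "Y closure_of (F ` S) \<subseteq> F ` topspace X"
    using assms(5) by (intro closure_of_minimal) auto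
qed

section \<open>The order of compactifications and the function sets that determine them\<close>

lemma cpn_le_imp_extendable:
  assumes "K \<le>\<^sub>c L"
  shows "extendable_functions K \<subseteq> extendable_functions L"
proof
  fix f assume f: "f \<in> extendable_functions K"
  obtain F where F: "continuous_map (fst L) (fst K) F" "\<And>n. F (snd L n) = snd K n"
    using assms by (auto simp: cpn_le_def)
  have "continuous_map (fst L) euclideanreal (cpn_ext K f \<circ> F)"
    using F(1) cpn_ext(1)[OF f] by (rule continuous_map_compose)
  then show "f \<in> extendable_functions L"
    using F(2) cpn_ext(2)[OF f] extendable_bounded[OF f]
    by (auto simp: extendable_functions_def intro!: exI[of _ "cpn_ext K f \<circ> F"])
qed

text \<open>Evaluation at the functions extendable over \<open>K\<close> maps both spaces into one
  power of the reals. The images coincide, and the map from \<open>K\<close> is an embedding because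
  these functions separate its points; inverting it after the map from \<open>L\<close> gives the
  surjection.\<close>

lemma extendable_imp_cpn_le:
  assumes K: "compactification K" and L: "compactification L"
    and sub: "extendable_functions K \<subseteq> extendable_functions L"
  shows "K \<le>\<^sub>c L"
proof -
  define E where "E = extendable_functions K"
  define P where "P = product_topology (\<lambda>_::nat \<Rightarrow> real. euclideanreal) UNIV"
  define F where "F = (\<lambda>p f. if f \<in> E then cpn_ext K f p else 0)"
  define G where "G = (\<lambda>p f. if f \<in> E then cpn_ext L f p else 0)"
  have P: "Hausdorff_space P" "topspace P = UNIV"
    by (simp_all add: P_def Hausdorff_space_product_topology)
  have F: "continuous_map (fst K) P F" and G: "continuous_map (fst L) P G"
    unfolding P_def continuous_map_componentwise_UNIV F_def G_def
    using cpn_ext(1)[of _ K] cpn_ext(1)[of _ L] sub by (auto simp: E_def)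
  \<comment> \<open>Both evaluations agree on \<omega>, and each image is the closure of the image
    of \<omega>.\<close>
  have FG: "F ` range (snd K) = G ` range (snd L)"
  proof -
    have "F (snd K n) = G (snd L n)" for n
      using cpn_ext(2)[of _ K n] cpn_ext(2)[of _ L n] sub by (auto simp: F_def G_def E_def fun_eq_iff)
    then show ?thesis by (auto simp: image_iff)
  qed
  have "F ` topspace (fst K) = P closure_of (F ` range (snd K))"
    using K F compactification_range[OF K] P
    by (intro continuous_image_eq_closure_of) (auto simp: compactification_def)
  moreover have "G ` topspace (fst L) = P closure_of (G ` range (snd L))"
    using L G compactification_range[OF L] P
    by (intro continuous_image_eq_closure_of) (auto simp: compactification_def)
  ultimately have im: "G ` topspace (fst L) = F ` topspace (fst K)" by (simp add: FG)
  define Y where "Y = subtopology P (F ` topspace (fst K))"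
  have inj: "inj_on F (topspace (fst K))"
  proof (rule inj_onI, rule ccontr)
    fix p q assume pq: "p \<in> topspace (fst K)" "q \<in> topspace (fst K)" "F p = F q" "p \<noteq> q"
    then obtain f where "f \<in> E" "cpn_ext K f p \<noteq> cpn_ext K f q"
      using extendable_separates[OF K] unfolding E_def by metis
    with fun_cong[OF pq(3), of f] show False by (simp add: F_def)
  qed
  have "homeomorphic_map (fst K) Y F"
    using K F inj P by (intro continuous_imp_homeomorphic_map)
      (auto simp: Y_def compactification_def Hausdorff_space_subtopology continuous_map_in_subtopology)
  then obtain F' where F': "homeomorphic_maps (fst K) Y F F'"
    by (auto simp: homeomorphic_map_maps)
  have GY: "continuous_map (fst L) Y G"
    using G im by (auto simp: Y_def continuous_map_in_subtopology)
  have "continuous_map (fst L) (fst K) (F' \<circ> G)"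
    using F' GY by (auto simp: homeomorphic_maps_def intro: continuous_map_compose)
  moreover have F'F: "F' (F p) = p" if "p \<in> topspace (fst K)" for p
    using F' that by (auto simp: homeomorphic_maps_def)
  then have "(F' \<circ> G) ` topspace (fst L) = topspace (fst K)"
    unfolding image_comp[symmetric] im by (force simp: image_iff)
  moreover have "(F' \<circ> G) (snd L n) = snd K n" for n
  proof -
    have "G (snd L n) = F (snd K n)"
      using cpn_ext(2)[of _ K n] cpn_ext(2)[of _ L n] sub by (auto simp: F_def G_def E_def fun_eq_iff)
    then show ?thesis using F'F compactification_range[OF K] by simp
  qed
  ultimately show ?thesis unfolding cpn_le_def by blast
qed

text \<open>Both composites of the two maps fix the dense set \<omega>, so they are
  identities.\<close>

lemma cpn_antisym:
  assumes K: "compactification K" and L: "compactification L" and "K \<le>\<^sub>c L" "L \<le>\<^sub>c K"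
  shows "K \<simeq>\<^sub>c L"
proof -
  obtain f where f: "continuous_map (fst L) (fst K) f" "\<And>n. f (snd L n) = snd K n"
    using assms(3) by (auto simp: cpn_le_def)
  obtain g where g: "continuous_map (fst K) (fst L) g" "\<And>n. g (snd K n) = snd L n"
    using assms(4) by (auto simp: cpn_le_def)
  have "(f \<circ> g) p = id p" if "p \<in> topspace (fst K)" for p
    by (rule forall_in_closure_of_eq[where f = "f \<circ> g" and g = id and S = "range (snd K)",
          OF _ _ continuous_map_compose[OF g(1) f(1)] continuous_map_id])
      (use K f(2) g(2) that in \<open>auto simp: compactification_def\<close>)
  moreover have "(g \<circ> f) p = id p" if "p \<in> topspace (fst L)" for p
    by (rule forall_in_closure_of_eq[where f = "g \<circ> f" and g = id and S = "range (snd L)",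
          OF _ _ continuous_map_compose[OF f(1) g(1)] continuous_map_id])
      (use L f(2) g(2) that in \<open>auto simp: compactification_def\<close>)
  ultimately have "homeomorphic_maps (fst L) (fst K) f g"
    using f(1) g(1) by (auto simp: homeomorphic_maps_def)
  then have "homeomorphic_map (fst L) (fst K) f" by (rule homeomorphic_maps_imp_map)
  then show ?thesis using f(2) by (auto simp: cpn_equiv_def)
qed

lemma cpn_equiv_imp_le:
  assumes "K \<simeq>\<^sub>c L"
  shows "K \<le>\<^sub>c L"
proof -
  obtain f where f: "homeomorphic_map (fst L) (fst K) f" "\<forall>n. f (snd L n) = snd K n"
    using assms by (auto simp: cpn_equiv_def)
  show ?thesis
    unfolding cpn_le_def
    using homeomorphic_imp_continuous_map[OF f(1)] homeomorphic_imp_surjective_map[OF f(1)] f(2)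
    by (intro exI[of _ f] conjI)
qed

text \<open>Since \<omega> is embedded as a discrete space, some open \<open>U\<close> meets it only
  in the point \<open>n\<close>. A Urysohn function that is 0 at this point and 1 off
  \<open>U\<close> restricts to the complementary characteristic function.\<close>

lemma ind_singleton_extendable:
  assumes K: "compactification K"
  shows "ind (\<lambda>m. m = n) \<in> extendable_functions K"
proof -
  obtain X e where Xe: "K = (X, e)" by fastforce
  have hom: "homeomorphic_map (discrete_topology UNIV) (subtopology X (range e)) e"
    using K by (simp add: Xe compactification_def embedding_map_def)
  have "openin (subtopology X (range e)) (e ` {n})"
    using homeomorphic_imp_open_map[OF hom] unfolding open_map_def by (metis openin_discrete_topology subset_UNIV)
  then obtain U where U: "openin X U" "{e n} = U \<inter> range e"
    by (auto simp: openin_subtopology)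
  have inj: "e m = e n \<longleftrightarrow> m = n" for m
    using homeomorphic_imp_injective_map[OF hom] by (auto simp: inj_on_def)
  have nin: "e n \<in> topspace X" using compactification_range[OF K] by (simp add: Xe)
  have "closedin X (topspace X - U)" "e n \<notin> topspace X - U" using U by auto
  then obtain f where f: "f \<in> extendable_functions K" "cpn_ext K f (e n) = 0"
    "\<And>m. e m \<in> topspace X - U \<Longrightarrow> f m = 1"
    using compactification_Urysohn[OF K, of "e n" "topspace X - U"] nin unfolding Xe fst_conv snd_conv by metis
  have "f n = 0" using f(2) cpn_ext(2)[OF f(1), of n] by (simp add: Xe)
  moreover have "f m = 1" if "m \<noteq> n" for m
  proof (rule f(3))
    have "e m \<notin> U" using U(2) inj[of m] that by blast
    then show "e m \<in> topspace X - U" using compactification_range[OF K] by (simp add: Xe)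
  qed
  ultimately have eq: "ind (\<lambda>m. m = n) = (\<lambda>m. 1 - f m)" by (auto simp: fun_eq_iff)
  have "continuous_map (fst K) euclideanreal (\<lambda>p. 1 - cpn_ext K f p)"
    by (intro continuous_intros cpn_ext(1)[OF f(1)])
  moreover have "bounded (range (\<lambda>m. 1 - f m))" using bounded_ind[of "\<lambda>m. m = n"] by (simp only: eq)
  moreover have "\<forall>m. 1 - cpn_ext K f (snd K m) = 1 - f m" using cpn_ext(2)[OF f(1)] by simp
  ultimately show ?thesis unfolding extendable_functions_def eq mem_Collect_eq
    by (intro conjI exI[of _ "\<lambda>p. 1 - cpn_ext K f p"])
qed

text \<open>The space is the closure of \<omega> in a power of the reals, embedded by evaluation at
  the members of \<open>E\<close>. Boundedness gives compactness and the singletons give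
  discreteness. The coordinates separate points, so every extendable function lies in
  \<open>uc E\<close>.\<close>

lemma compactification_of_uc_closed:
  assumes bdd: "\<And>f. f \<in> E \<Longrightarrow> bounded (range f)"
    and ind: "\<And>n. ind (\<lambda>m. m = n) \<in> E"
    and closed: "uc E \<subseteq> E"
  obtains K :: "univ cpn" where "compactification K" "extendable_functions K = E"
proof -
  \<comment> \<open>The exponent is the whole type of functions, so coordinates outside
    \<open>E\<close> are filled with 0.\<close>
  define e :: "nat \<Rightarrow> univ" where "e n = (\<lambda>f. if f \<in> E then f n else 0)" for n
  define P where "P = product_topology (\<lambda>_::nat \<Rightarrow> real. euclideanreal) UNIV"
  define X where "X = subtopology P (P closure_of range e)"
  have P: "Hausdorff_space P" "topspace P = UNIV"
    by (simp_all add: P_def Hausdorff_space_product_topology)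
  have tX: "topspace X = P closure_of range e" by (simp add: X_def P)
  have eX: "e n \<in> topspace X" for n
    using closure_of_subset[of "range e" P] by (auto simp: tX P)
  have "\<forall>f\<in>E. \<exists>B. \<forall>n. \<bar>f n\<bar> \<le> B" using bdd by (auto simp: bounded_iff)
  then obtain B where B: "\<And>f n. f \<in> E \<Longrightarrow> \<bar>f n\<bar> \<le> B f" by metis
  \<comment> \<open>Outside \<open>E\<close> the number \<open>B f\<close> is arbitrary; its
    absolute value ensures that the interval contains the default 0.\<close>
  define Q where "Q = Pi\<^sub>E UNIV (\<lambda>f. {- \<bar>B f\<bar>..\<bar>B f\<bar>})"
  have cQ: "compactin P Q"
    unfolding P_def Q_def by (auto simp: compactin_PiE)
  have "range e \<subseteq> Q"
  proof -
    have "e n f \<in> {- \<bar>B f\<bar>..\<bar>B f\<bar>}" for n f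
      using B[of f n] by (auto simp: e_def)
    then show ?thesis by (auto simp: Q_def)
  qed
  then have "P closure_of range e \<subseteq> Q"
    using compactin_imp_closedin[OF P(1) cQ] by (rule closure_of_minimal)
  then have "compactin P (P closure_of range e)"
    by (rule closed_compactin[OF cQ _ closedin_closure_of])
  then have compact: "compact_space X"
    by (simp add: X_def compact_space_subtopology)
  have haus: "Hausdorff_space X" unfolding X_def by (rule Hausdorff_space_subtopology[OF P(1)])
  have proj: "continuous_map X euclideanreal (\<lambda>p. p f)" for f
    unfolding X_def P_def
    by (intro continuous_map_from_subtopology continuous_map_product_projection) simp
  have inj: "e m = e n \<longleftrightarrow> m = n" for m n
  proof
    assume "e m = e n"
    from fun_cong[OF this, of "ind (\<lambda>m. m = n)"] show "m = n" using ind by (auto simp: e_def)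
  qed simp
  have "openin (subtopology X (range e)) (e ` S)" for S
  proof -
    \<comment> \<open>The coordinate at the characteristic function of \<open>n\<close> isolates
      \<open>e n\<close> among the points of \<omega>.\<close>
    define W where "W n = {p \<in> topspace X. p (ind (\<lambda>m. m = n)) \<in> {1/2<..}}" for n
    have "openin X (W n)" for n
      unfolding W_def by (rule openin_continuous_map_preimage[OF proj]) simp
    then have "openin X (\<Union>n\<in>S. W n)" by blast
    moreover have "e m \<in> W n \<longleftrightarrow> m = n" for m n
      using ind[of n] eX[of m] by (auto simp: W_def e_def)
    then have "(\<Union>n\<in>S. W n) \<inter> range e = e ` S" by auto
    ultimately show ?thesis unfolding openin_subtopology by (intro exI[of _ "\<Union>n\<in>S. W n"] conjI) (simp_all only:)
  qed
  then have "homeomorphic_map (discrete_topology UNIV) (subtopology X (range e)) e"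
    using eX inj
    by (intro bijective_open_imp_homeomorphic_map)
      (auto simp: open_map_def continuous_map_in_subtopology inj_on_def topspace_subtopology_subset image_subset_iff)
  then have emb: "embedding_map (discrete_topology UNIV) X e"
    by (simp add: embedding_map_def)
  have dense: "X closure_of range e = topspace X"
    using eX closure_of_subset[of "range e" P] by (auto simp: X_def closure_of_subtopology P Int_absorb1)
  have K: "compactification (X, e)"
    using compact haus emb dense by (simp add: compactification_def)
  have ex: "f \<in> extendable_functions (X, e)" if "f \<in> E" for f
    using proj[of f] bdd[OF that] that by (auto simp: extendable_functions_def e_def)
  have ext_eq: "cpn_ext (X, e) f p = p f" if "f \<in> E" "p \<in> topspace X" for f p
    by (rule cpn_ext_unique[OF K ex]) (use that proj[of f] in \<open>auto simp: e_def\<close>)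
  have "extendable_functions (X, e) \<subseteq> uc E"
  proof (rule extendable_subset_uc[OF K])
    fix p q assume pq: "p \<in> topspace (fst (X, e))" "q \<in> topspace (fst (X, e))" "p \<noteq> q"
    \<comment> \<open>The default value persists in the closure, so distinct points must differ at a
      coordinate in \<open>E\<close>.\<close>
    have zero: "p f = 0" if "f \<notin> E" "p \<in> topspace X" for f p
      by (rule forall_in_closure_of_eq[where X = X and Y = euclideanreal and S = "range e"
            and f = "\<lambda>p. p f" and g = "\<lambda>_. 0"])
        (use that dense proj[of f] in \<open>auto simp: e_def\<close>)
    obtain f where "p f \<noteq> q f" using pq(3) by auto
    then have "f \<in> E" using zero[of f p] zero[of f q] pq(1,2) by (metis fst_conv)
    with pq \<open>p f \<noteq> q f\<close> show "\<exists>f\<in>E. cpn_ext (X, e) f p \<noteq> cpn_ext (X, e) f q" by (auto simp: ext_eq)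
  qed (use ex in blast)
  with closed ex have "extendable_functions (X, e) = E" by blast
  with K show thesis by (rule that)
qed

text \<open>Let \<open>L\<close> be the compactification with function set \<open>uc ?C\<close>.
  Points of \<open>L\<close> with the same image in \<open>K\<close> are not separated by
  \<open>?C\<close>, hence not by functions that \<open>?C\<close> controls uniformly. So the map
  from \<open>L\<close> to \<open>K\<close> is a homeomorphism.\<close>

lemma uc_extendable:
  assumes K: "compactification K"
  shows "uc (extendable_functions K) \<subseteq> extendable_functions K"
proof -
  let ?C = "extendable_functions K"
  have sub: "?C \<subseteq> uc ?C" by (rule subset_uc) (rule extendable_bounded)
  have ind: "ind (\<lambda>m. m = n) \<in> uc ?C" for n
    using ind_singleton_extendable[OF K] sub by (rule subsetD[rotated])
  obtain L :: "univ cpn" where L: "compactification L" "extendable_functions L = uc ?C"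
    by (rule compactification_of_uc_closed[OF uc_bounded ind uc_uc_subset])
  have "K \<le>\<^sub>c L" using sub L K by (intro extendable_imp_cpn_le) auto
  then obtain F where F: "continuous_map (fst L) (fst K) F" "F ` topspace (fst L) = topspace (fst K)"
    "\<And>n. F (snd L n) = snd K n" by (auto simp: cpn_le_def)
  have "inj_on F (topspace (fst L))"
  proof (rule inj_onI, rule ccontr)
    fix p q assume pq: "p \<in> topspace (fst L)" "q \<in> topspace (fst L)" "F p = F q" "p \<noteq> q"
    then obtain h where h: "h \<in> uc ?C" "cpn_ext L h p \<noteq> cpn_ext L h q"
      using extendable_separates[OF L(1)] unfolding L(2) by metis
    \<comment> \<open>A third of the gap, since the final estimate has three error terms below
      \<epsilon>.\<close>
    define \<epsilon> where "\<epsilon> = \<bar>cpn_ext L h p - cpn_ext L h q\<bar> / 3"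
    have \<epsilon>: "\<epsilon> > 0" using h(2) by (simp add: \<epsilon>_def)
    obtain G \<delta> where G: "finite G" "G \<subseteq> ?C" "\<delta> > 0"
      "\<forall>n m. (\<forall>g\<in>G. \<bar>g n - g m\<bar> < \<delta>) \<longrightarrow> \<bar>h n - h m\<bar> < \<epsilon>"
      by (rule ucE[OF h(1) \<epsilon>])
    \<comment> \<open>Density yields a point of \<omega> so close to \<open>p\<close> that
      \<open>h\<close> and the finitely many \<open>g\<close> almost attain their values at
      \<open>p\<close>.\<close>
    have approx: "\<exists>n. (\<forall>g\<in>G. \<bar>g n - cpn_ext K g (F p)\<bar> < \<delta> / 2) \<and> \<bar>h n - cpn_ext L h p\<bar> < \<epsilon>"
      if p: "p \<in> topspace (fst L)" for p
    proof -
      define U where "U g = {p' \<in> topspace (fst L). \<bar>cpn_ext K g (F p') - cpn_ext K g (F p)\<bar> \<in> {..<\<delta> / 2}}" for g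
      define V where "V = {p' \<in> topspace (fst L). \<bar>cpn_ext L h p' - cpn_ext L h p\<bar> \<in> {..<\<epsilon>}}"
      have "openin (fst L) (U g)" if "g \<in> G" for g
        unfolding U_def
        using continuous_map_compose[OF F(1) cpn_ext(1)[of g K], unfolded comp_def] G(2) that
        by (intro openin_continuous_map_preimage[where Y = euclideanreal] continuous_intros) auto
      moreover have "openin (fst L) V"
        unfolding V_def using cpn_ext(1)[of h L] h(1) L(2)
        by (intro openin_continuous_map_preimage[where Y = euclideanreal] continuous_intros) auto
      ultimately have "openin (fst L) (\<Inter> (insert V (U ` G)))"
        using G(1) by (intro openin_Inter) auto
      moreover have "p \<in> \<Inter> (insert V (U ` G))"
        using p G(3) \<epsilon> by (auto simp: U_def V_def)
      ultimately obtain n where n: "snd L n \<in> \<Inter> (insert V (U ` G))"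
        using compactification_dense[OF L(1) p] by metis
      have "\<bar>g n - cpn_ext K g (F p)\<bar> < \<delta> / 2" if "g \<in> G" for g
      proof -
        have "snd L n \<in> U g" using n that by blast
        moreover have "cpn_ext K g (F (snd L n)) = g n" using F(3) cpn_ext(2)[of g K n] G(2) that by auto
        ultimately show ?thesis by (simp add: U_def)
      qed
      moreover have "\<bar>h n - cpn_ext L h p\<bar> < \<epsilon>"
        using n cpn_ext(2)[of h L n] h(1) L(2) by (simp add: V_def)
      ultimately show ?thesis by blast
    qed
    obtain n where n: "\<forall>g\<in>G. \<bar>g n - cpn_ext K g (F p)\<bar> < \<delta> / 2" "\<bar>h n - cpn_ext L h p\<bar> < \<epsilon>"
      using approx[OF pq(1)] by blast
    obtain m where m: "\<forall>g\<in>G. \<bar>g m - cpn_ext K g (F p)\<bar> < \<delta> / 2" "\<bar>h m - cpn_ext L h q\<bar> < \<epsilon>"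
      using approx[OF pq(2)] pq(3) by metis
    have "\<bar>h n - h m\<bar> < \<epsilon>"
    proof (rule G(4)[rule_format])
      fix g assume g: "g \<in> G"
      have "\<bar>g n - cpn_ext K g (F p)\<bar> < \<delta> / 2" "\<bar>g m - cpn_ext K g (F p)\<bar> < \<delta> / 2"
        using n(1) m(1) g by auto
      then show "\<bar>g n - g m\<bar> < \<delta>" by linarith
    qed
    moreover have "\<bar>cpn_ext L h p - cpn_ext L h q\<bar> \<le> \<bar>h n - cpn_ext L h p\<bar> + \<bar>h n - h m\<bar> + \<bar>h m - cpn_ext L h q\<bar>"
      by linarith
    moreover have "\<bar>cpn_ext L h p - cpn_ext L h q\<bar> = 3 * \<epsilon>" by (simp add: \<epsilon>_def)
    ultimately show False using n(2) m(2) by linarith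
  qed
  then have "homeomorphic_map (fst L) (fst K) F"
    using F L(1) K by (intro continuous_imp_homeomorphic_map) (auto simp: compactification_def)
  then obtain F' where F': "homeomorphic_maps (fst L) (fst K) F F'"
    by (auto simp: homeomorphic_map_maps)
  have F'F: "F' (F p) = p" if "p \<in> topspace (fst L)" for p
    using F' that by (auto simp: homeomorphic_maps_def)
  have "L \<le>\<^sub>c K"
    unfolding cpn_le_def
  proof (intro exI[of _ F'] conjI allI)
    show "continuous_map (fst K) (fst L) F'" using F' by (simp add: homeomorphic_maps_def)
    show "F' ` topspace (fst K) = topspace (fst L)"
      unfolding F(2)[symmetric] using F'F by (force simp: image_iff)
    show "F' (snd K n) = snd L n" for n
      using F'F[OF compactification_range[OF L(1)]] F(3) by metis
  qed
  with L(2) show ?thesis using cpn_le_imp_extendable by blast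
qed

section \<open>The function sets of the Stone-Cech compactification and of suprema\<close>

lemma cpn_le_iff_extendable:
  assumes "compactification K" "compactification L"
  shows "K \<le>\<^sub>c L \<longleftrightarrow> extendable_functions K \<subseteq> extendable_functions L"
  using cpn_le_imp_extendable extendable_imp_cpn_le[OF assms] by blast

text \<open>The set of all bounded functions is closed under \<open>uc\<close>, so it belongs to a
  compactification \<open>B\<close> lying above all others. The chosen largest element lies above
  \<open>B\<close> and therefore extends all bounded functions too.\<close>

lemma stone_cech:
  "compactification stone_cech" "extendable_functions stone_cech = {f. bounded (range f)}"
proof -
  have "ind x \<in> {f. bounded (range f)}" for x using bounded_ind by blast
  moreover have "uc {f. bounded (range f)} \<subseteq> {f. bounded (range f)}" using uc_bounded by blast
  ultimately obtain B :: "univ cpn"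
    where B: "compactification B" "extendable_functions B = {f. bounded (range f)}"
    using compactification_of_uc_closed[of "{f. bounded (range f)}"] by blast
  have "\<exists>B :: univ cpn. compactification B \<and> (\<forall>K :: univ cpn. compactification K \<longrightarrow> K \<le>\<^sub>c B)"
  proof (intro exI[of _ B] conjI allI impI)
    fix K :: "univ cpn" assume "compactification K"
    then show "K \<le>\<^sub>c B"
      unfolding cpn_le_iff_extendable[OF \<open>compactification K\<close> B(1)] B(2)
      by (auto intro: extendable_bounded[of _ K])
  qed (rule B(1))
  from someI_ex[OF this, folded stone_cech_def] have S: "compactification stone_cech"
    "\<And>K :: univ cpn. compactification K \<Longrightarrow> K \<le>\<^sub>c stone_cech"
    by blast+
  show "compactification stone_cech" by (rule S(1))
  show "extendable_functions stone_cech = {f. bounded (range f)}"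
    using cpn_le_imp_extendable[OF S(2)[OF B(1)]] B(2) extendable_bounded by blast
qed

lemma stone_cech_equiv_iff:
  assumes "compactification (K :: univ cpn)"
  shows "stone_cech \<simeq>\<^sub>c K \<longleftrightarrow> {f. bounded (range f)} \<subseteq> extendable_functions K"
proof
  assume "stone_cech \<simeq>\<^sub>c K"
  then show "{f. bounded (range f)} \<subseteq> extendable_functions K"
    using cpn_le_imp_extendable[OF cpn_equiv_imp_le] stone_cech(2) by blast
next
  assume "{f. bounded (range f)} \<subseteq> extendable_functions K"
  then show "stone_cech \<simeq>\<^sub>c K"
    using assms stone_cech by (intro cpn_antisym) (auto simp: cpn_le_iff_extendable intro: extendable_bounded[of _ K])
qed

text \<open>The function set of every upper bound contains the union and, by
  \<open>uc_extendable\<close>, also its \<open>uc\<close>. A member of the nonempty family supplies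
  the characteristic functions of singletons needed to realize this \<open>uc\<close> by a
  compactification.\<close>

lemma cpn_sup:
  assumes "\<K> \<noteq> {}" and K: "\<And>K. K \<in> \<K> \<Longrightarrow> compactification K"
  shows "compactification (cpn_sup \<K>)"
    and "extendable_functions (cpn_sup \<K>) = uc (\<Union>K\<in>\<K>. extendable_functions K)"
proof -
  let ?E = "\<Union>K\<in>\<K>. extendable_functions K"
  have sub: "?E \<subseteq> uc ?E" by (rule subset_uc) (auto intro: extendable_bounded)
  have ind: "ind (\<lambda>m. m = n) \<in> uc ?E" for n
  proof -
    obtain L where L: "L \<in> \<K>" using assms(1) by blast
    have "ind (\<lambda>m. m = n) \<in> ?E" using ind_singleton_extendable[OF K[OF L]] L by (rule UN_I[rotated])
    then show ?thesis using sub by (rule subsetD[rotated])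
  qed
  obtain S :: "univ cpn" where S: "compactification S" "extendable_functions S = uc ?E"
    by (rule compactification_of_uc_closed[OF uc_bounded ind uc_uc_subset])
  have le: "K \<le>\<^sub>c S" if "K \<in> \<K>" for K
    using that K S sub by (auto simp: cpn_le_iff_extendable)
  have least: "S \<le>\<^sub>c T" if T: "compactification T" "\<forall>K\<in>\<K>. K \<le>\<^sub>c T" for T :: "univ cpn"
  proof -
    have "?E \<subseteq> extendable_functions T" using T(2) cpn_le_imp_extendable by blast
    then have "uc ?E \<subseteq> extendable_functions T"
      using uc_mono uc_extendable[OF T(1)] by blast
    then show ?thesis using S T(1) by (simp add: cpn_le_iff_extendable)
  qed
  have "is_cpn_sup \<K> S" using S(1) le least by (auto simp: is_cpn_sup_def)
  then have sup: "is_cpn_sup \<K> (cpn_sup \<K>)" unfolding cpn_sup_def by (rule someI)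
  then show "compactification (cpn_sup \<K>)" by (simp add: is_cpn_sup_def)
  have "S \<le>\<^sub>c cpn_sup \<K>" "cpn_sup \<K> \<le>\<^sub>c S"
    using sup S(1) le least unfolding is_cpn_sup_def by blast+
  then show "extendable_functions (cpn_sup \<K>) = uc ?E"
    using cpn_le_imp_extendable S(2) by blast
qed

section \<open>Higson rings\<close>

lemma PM_D:
  assumes "d \<in> PM"
  shows "d x y = d y x" "finite {y. d x y < r}"
proof -
  interpret Metric_space UNIV d using assms by (simp add: PM_def)
  show "d x y = d y x" by (rule commute)
  have "compactin (discrete_topology UNIV) (discrete_topology UNIV closure_of mball x r)"
    using assms mbounded_mball by (simp add: PM_def)
  then have "finite (mball x r)" by (simp add: discrete_topology_closure_of compactin_discrete_topology)
  then show "finite {y. d x y < r}" by (simp add: mball_def)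
qed

lemma eventually_notin_finite: "finite A \<Longrightarrow> \<forall>\<^sub>F n in sequentially. n \<notin> (A :: nat set)"
  by (simp add: cofinite_eq_sequentially[symmetric] eventually_cofinite)

text \<open>Distances to the value at the centre replace the diameter, at the cost of a factor 2,
  and the complement of a finite set becomes a tail.\<close>

lemma higson_ring_iff:
  assumes d: "d \<in> PM"
  shows "f \<in> higson_ring d \<longleftrightarrow> bounded (range f) \<and>
    (\<forall>r>0. \<forall>\<epsilon>>0. \<forall>\<^sub>F n in sequentially. \<forall>m. d n m < r \<longrightarrow> \<bar>f n - f m\<bar> \<le> \<epsilon>)"
proof -
  interpret Metric_space UNIV d using d by (simp add: PM_def)
  have "slowly_oscillating d f \<longleftrightarrow>
    (\<forall>r>0. \<forall>\<epsilon>>0. \<forall>\<^sub>F n in sequentially. \<forall>m. d n m < r \<longrightarrow> \<bar>f n - f m\<bar> \<le> \<epsilon>)"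
    if bdd: "bounded (range f)"
  proof (intro iffI allI impI)
    fix r \<epsilon> :: real
    assume so: "slowly_oscillating d f" and r: "r > 0" and \<epsilon>: "\<epsilon> > 0"
    obtain K where K: "finite K" "\<And>x. x \<notin> K \<Longrightarrow> diameter (f ` mball x r) < \<epsilon>"
      using so r \<epsilon> unfolding slowly_oscillating_def by blast
    have "\<bar>f n - f m\<bar> \<le> \<epsilon>" if "n \<notin> K" "d n m < r" for n m
    proof -
      have "bounded (f ` mball n r)" by (rule bounded_subset[OF bdd]) auto
      moreover have "f n \<in> f ` mball n r" "f m \<in> f ` mball n r" using r that by auto
      ultimately have "dist (f n) (f m) \<le> diameter (f ` mball n r)"
        by (rule diameter_bounded_bound)
      with K(2)[OF that(1)] show ?thesis by (simp add: dist_real_def)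
    qed
    with eventually_notin_finite[OF K(1)]
    show "\<forall>\<^sub>F n in sequentially. \<forall>m. d n m < r \<longrightarrow> \<bar>f n - f m\<bar> \<le> \<epsilon>"
      by (auto elim!: eventually_mono)
  next
    assume ev: "\<forall>r>0. \<forall>\<epsilon>>0. \<forall>\<^sub>F n in sequentially. \<forall>m. d n m < r \<longrightarrow> \<bar>f n - f m\<bar> \<le> \<epsilon>"
    show "slowly_oscillating d f"
      unfolding slowly_oscillating_def
    proof (intro allI impI)
      fix r \<epsilon> :: real assume r: "r > 0" and \<epsilon>: "\<epsilon> > 0"
      \<comment> \<open>A quarter of \<epsilon> bounds the diameter by half of \<epsilon>, which
        restores the strict inequality.\<close>
      have "\<forall>\<^sub>F n in sequentially. \<forall>m. d n m < r \<longrightarrow> \<bar>f n - f m\<bar> \<le> \<epsilon> / 4"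
        by (rule ev[rule_format]) (use r \<epsilon> in simp_all)
      then obtain N where N: "\<And>n m. n \<ge> N \<Longrightarrow> d n m < r \<Longrightarrow> \<bar>f n - f m\<bar> \<le> \<epsilon> / 4"
        unfolding eventually_sequentially by blast
      have "diameter (f ` mball n r) < \<epsilon>" if "n \<notin> {..<N}" for n
      proof -
        have "norm (x - y) \<le> \<epsilon> / 2" if xy: "x \<in> f ` mball n r" "y \<in> f ` mball n r" for x y
        proof -
          obtain k l where kl: "x = f k" "d n k < r" "y = f l" "d n l < r" using xy by auto
          have "\<bar>f n - f k\<bar> \<le> \<epsilon> / 4" "\<bar>f n - f l\<bar> \<le> \<epsilon> / 4"
            using N[of n] kl \<open>n \<notin> _\<close> by auto
          then show ?thesis unfolding kl real_norm_def by linarith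
        qed
        then have "diameter (f ` mball n r) \<le> \<epsilon> / 2" using \<epsilon> by (intro diameter_le) auto
        with \<epsilon> show ?thesis by linarith
      qed
      then show "\<exists>K. finite K \<and> (\<forall>x. x \<notin> K \<longrightarrow> diameter (f ` mball x r) < \<epsilon>)"
        by (intro exI[of _ "{..<N}"]) simp
    qed
  qed
  then show ?thesis unfolding higson_ring_def by blast
qed

text \<open>Finitely many functions satisfy their estimates on a common tail, and these control
  \<open>f\<close>. This realizes the Higson ring by a compactification.\<close>

lemma uc_higson_ring:
  assumes d: "d \<in> PM"
  shows "uc (higson_ring d) \<subseteq> higson_ring d"
proof
  fix f assume f: "f \<in> uc (higson_ring d)"
  show "f \<in> higson_ring d"
    unfolding higson_ring_iff[OF d]
  proof (intro conjI allI impI uc_bounded[OF f])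
    fix r \<epsilon> :: real assume r: "r > 0" and \<epsilon>: "\<epsilon> > 0"
    obtain G \<delta> where G: "finite G" "G \<subseteq> higson_ring d" "\<delta> > 0"
      "\<forall>n m. (\<forall>g\<in>G. \<bar>g n - g m\<bar> < \<delta>) \<longrightarrow> \<bar>f n - f m\<bar> < \<epsilon>"
      by (rule ucE[OF f \<epsilon>])
    have "\<forall>\<^sub>F n in sequentially. \<forall>m. d n m < r \<longrightarrow> \<bar>g n - g m\<bar> \<le> \<delta> / 2" if "g \<in> G" for g
    proof -
      have "g \<in> higson_ring d" using that G(2) by blast
      then show ?thesis using r half_gt_zero[OF G(3)] unfolding higson_ring_iff[OF d] by blast
    qed
    then have "\<forall>\<^sub>F n in sequentially. \<forall>g\<in>G. \<forall>m. d n m < r \<longrightarrow> \<bar>g n - g m\<bar> \<le> \<delta> / 2"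
      using G(1) by (simp add: eventually_ball_finite)
    then show "\<forall>\<^sub>F n in sequentially. \<forall>m. d n m < r \<longrightarrow> \<bar>f n - f m\<bar> \<le> \<epsilon>"
    proof (rule eventually_mono, intro allI impI)
      fix n m assume *: "\<forall>g\<in>G. \<forall>m. d n m < r \<longrightarrow> \<bar>g n - g m\<bar> \<le> \<delta> / 2" and "d n m < r"
      have "\<bar>g n - g m\<bar> < \<delta>" if "g \<in> G" for g
      proof -
        have "\<bar>g n - g m\<bar> \<le> \<delta> / 2" using * that \<open>d n m < r\<close> by blast
        with G(3) show ?thesis by linarith
      qed
      then have "\<bar>f n - f m\<bar> < \<epsilon>" using G(4) by blast
      then show "\<bar>f n - f m\<bar> \<le> \<epsilon>" by simp
    qed
  qed
qed

text \<open>Balls of radius \<open>r\<close> around the first \<open>T\<close> points are finite, so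
  the ball around any late \<open>n\<close> avoids these points, and \<open>u\<close> is almost
  constant on it.\<close>

lemma convergent_in_higson_ring:
  assumes d: "d \<in> PM" and u: "u \<longlonglongrightarrow> L"
  shows "u \<in> higson_ring d"
  unfolding higson_ring_iff[OF d]
proof (intro conjI allI impI)
  show "bounded (range u)" using u by (rule convergent_imp_bounded)
  fix r \<epsilon> :: real assume r: "r > 0" and \<epsilon>: "\<epsilon> > 0"
  obtain T where T: "\<And>n. n \<ge> T \<Longrightarrow> \<bar>u n - L\<bar> < \<epsilon> / 2"
    using LIMSEQ_D[OF u, of "\<epsilon> / 2"] \<epsilon> by auto
  have "finite (\<Union>k\<in>{..<T}. {n. d k n < r})" using PM_D(2)[OF d] by simp
  then have "\<forall>\<^sub>F n in sequentially. n \<notin> (\<Union>k\<in>{..<T}. {n. d k n < r})"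
    by (rule eventually_notin_finite)
  with eventually_ge_at_top[of T]
  show "\<forall>\<^sub>F n in sequentially. \<forall>m. d n m < r \<longrightarrow> \<bar>u n - u m\<bar> \<le> \<epsilon>"
  proof eventually_elim
    case (elim n)
    show ?case
    proof (intro allI impI)
      fix m assume "d n m < r"
      then have "m \<ge> T" using elim(2) PM_D(1)[OF d, of n m] by force
      then show "\<bar>u n - u m\<bar> \<le> \<epsilon>" using T[of n] T[of m] elim(1) by linarith
    qed
  qed
qed

lemma higson_ring_bounded: "f \<in> higson_ring d \<Longrightarrow> bounded (range f)"
  by (simp add: higson_ring_def)

lemma ind_singleton_in_higson_ring:
  assumes "d \<in> PM"
  shows "ind (\<lambda>m. m = k) \<in> higson_ring d"
proof (rule convergent_in_higson_ring[OF assms])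
  have "\<forall>\<^sub>F n in sequentially. ind (\<lambda>m. m = k) n = 0"
    using eventually_gt_at_top[of k] by (rule eventually_mono) simp
  then show "ind (\<lambda>m. m = k) \<longlonglongrightarrow> 0" by (rule tendsto_eventually)
qed

lemma higson:
  assumes d: "d \<in> PM"
  shows "compactification (higson d)" "extendable_functions (higson d) = higson_ring d"
proof -
  obtain K :: "univ cpn" where "compactification K" "extendable_functions K = higson_ring d"
    by (rule compactification_of_uc_closed[OF higson_ring_bounded ind_singleton_in_higson_ring[OF d] uc_higson_ring[OF d]])
  then have "\<exists>K :: univ cpn. compactification K \<and> extendable_functions K = higson_ring d" by blast
  from someI_ex[OF this, folded higson_def]
  show "compactification (higson d)" "extendable_functions (higson d) = higson_ring d"
    by blast+
qed

section \<open>The groups of clopen sets\<close>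

text \<open>The group \<open>H\<^sub>F\<close> of the overview. For nonempty
  \<open>F \<subseteq> PM\<close> it consists of the traces on \<omega> of the clopen subsets of the
  supremum.\<close>

definition clopen_group :: "(nat \<Rightarrow> nat \<Rightarrow> real) set \<Rightarrow> (nat \<Rightarrow> bool) set" where
  "clopen_group F = {x. ind x \<in> uc (\<Union>d\<in>F. higson_ring d)}"

text \<open>The supremum is the Stone-Cech compactification once all bounded functions extend, and
  by \<open>bounded_in_uc_of_ind\<close> two-valued ones suffice.\<close>

lemma higson_sup:
  assumes "F \<noteq> {}" "F \<subseteq> PM"
  shows "stone_cech \<simeq>\<^sub>c cpn_sup (higson ` F) \<longleftrightarrow> clopen_group F = UNIV"
proof -
  have ne: "higson ` F \<noteq> {}" using assms by simp
  have cp: "compactification K" if "K \<in> higson ` F" for K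
    using that assms(2) higson(1) by blast
  have "(\<Union>K\<in>higson ` F. extendable_functions K) = (\<Union>d\<in>F. higson_ring d)"
    using assms(2) higson(2) by (simp add: subset_iff)
  with cpn_sup(2)[OF ne cp]
  have ext: "extendable_functions (cpn_sup (higson ` F)) = uc (\<Union>d\<in>F. higson_ring d)" by simp
  have "stone_cech \<simeq>\<^sub>c cpn_sup (higson ` F) \<longleftrightarrow> {f. bounded (range f)} \<subseteq> uc (\<Union>d\<in>F. higson_ring d)"
    using stone_cech_equiv_iff[OF cpn_sup(1)[OF ne cp]] by (simp only: ext)
  also have "\<dots> \<longleftrightarrow> (\<forall>x. ind x \<in> uc (\<Union>d\<in>F. higson_ring d))"
    using bounded_ind bounded_in_uc_of_ind by (intro iffI allI subsetI) auto
  also have "\<dots> \<longleftrightarrow> clopen_group F = UNIV" by (auto simp: clopen_group_def)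
  finally show ?thesis .
qed

lemma ind_diff_less_1_iff: "\<bar>ind x n - ind x m\<bar> < 1 \<longleftrightarrow> x n = x m"
  by (simp add: of_bool_def)

text \<open>Every element is its own inverse, and the sum of \<open>x\<close> and \<open>y\<close>
  is controlled by \<open>ind x\<close> and \<open>ind y\<close>.\<close>

lemma subgroup_clopen_group: "subgroup (clopen_group F) cantor_group"
proof (rule group.subgroupI[OF group_cantor_group])
  show "clopen_group F \<subseteq> carrier cantor_group" by (simp add: cantor_group_def)
  have "ind (\<lambda>_. False) \<in> uc (\<Union>d\<in>F. higson_ring d)"
    unfolding ind_in_uc_iff by (intro exI[of _ "{}"] exI[of _ 1]) simp
  then show "clopen_group F \<noteq> {}" unfolding clopen_group_def by blast
  fix x assume x: "x \<in> clopen_group F"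
  have "inv\<^bsub>cantor_group\<^esub> x = x"
    by (rule group.inv_equality[OF group_cantor_group]) (simp_all add: cantor_group_def)
  with x show "inv\<^bsub>cantor_group\<^esub> x \<in> clopen_group F" by simp
  fix y assume y: "y \<in> clopen_group F"
  have "ind (\<lambda>n. x n \<noteq> y n) \<in> uc {ind x, ind y}"
    unfolding ind_in_uc_iff
    by (intro exI[of _ "{ind x, ind y}"] exI[of _ 1]) (simp del: ind_apply add: ind_diff_less_1_iff)
  also have "uc {ind x, ind y} \<subseteq> uc (uc (\<Union>d\<in>F. higson_ring d))"
    using x y by (intro uc_mono) (simp add: clopen_group_def)
  also have "\<dots> \<subseteq> uc (\<Union>d\<in>F. higson_ring d)" by (rule uc_uc_subset)
  finally show "x \<otimes>\<^bsub>cantor_group\<^esub> y \<in> clopen_group F"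
    by (simp add: clopen_group_def cantor_group_def)
qed

text \<open>The modified set is controlled by \<open>ind x\<close> and the characteristic functions
  of the changed points: two distinct points that these singletons do not separate are both
  unchanged.\<close>

lemma clopen_group_finite_modifications:
  assumes "F \<noteq> {}" "F \<subseteq> PM"
  shows "closed_under_finite_modifications (clopen_group F)"
proof -
  let ?E = "\<Union>d\<in>F. higson_ring d"
  have "y \<in> clopen_group F" if x: "x \<in> clopen_group F" and fin: "finite {n. x n \<noteq> y n}" for x y
  proof -
    define S where "S = (\<lambda>k. ind (\<lambda>m. m = k)) ` {n. x n \<noteq> y n}"
    have "y n = y m" if *: "\<forall>g\<in>insert (ind x) S. \<bar>g n - g m\<bar> < 1" for n m
    proof (cases "n = m")
      case False
      have "(n = k) = (m = k)" if "x k \<noteq> y k" for k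
      proof -
        have "ind (\<lambda>m. m = k) \<in> S"
          unfolding S_def using that by (intro image_eqI[of _ _ k] refl) simp
        then have "\<bar>ind (\<lambda>m. m = k) n - ind (\<lambda>m. m = k) m\<bar> < 1"
          by (intro bspec[OF *] insertI2)
        then show ?thesis unfolding ind_diff_less_1_iff .
      qed
      from this[of n] this[of m] False have "x n = y n" "x m = y m" by auto
      moreover have "x n = x m" using * by (simp del: ind_apply add: ind_diff_less_1_iff)
      ultimately show ?thesis by simp
    qed simp
    moreover have "finite (insert (ind x) S)" using fin by (simp add: S_def)
    ultimately have "ind y \<in> uc (insert (ind x) S)"
      unfolding ind_in_uc_iff
      by (intro exI[of _ "insert (ind x) S"] exI[of _ 1] conjI allI impI subset_refl zero_less_one)
    also have "uc (insert (ind x) S) \<subseteq> uc (uc ?E)"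
    proof (rule uc_mono)
      obtain d where "d \<in> F" using assms(1) by blast
      moreover from this have "d \<in> PM" using assms(2) by blast
      then have "S \<subseteq> higson_ring d"
        unfolding S_def by (intro image_subsetI ind_singleton_in_higson_ring)
      ultimately have "S \<subseteq> ?E" by blast
      also have "?E \<subseteq> uc ?E" by (rule subset_uc) (auto intro: higson_ring_bounded)
      finally show "insert (ind x) S \<subseteq> uc ?E" using x by (simp add: clopen_group_def)
    qed
    also have "\<dots> \<subseteq> uc ?E" by (rule uc_uc_subset)
    finally show ?thesis by (simp add: clopen_group_def)
  qed
  note step = this
  show ?thesis
    unfolding closed_under_finite_modifications_def
  proof (intro allI impI iffI)
    fix x y :: "nat \<Rightarrow> bool" assume fin: "finite {n. x n \<noteq> y n}"
    show "y \<in> clopen_group F" if "x \<in> clopen_group F" using step[OF that fin] .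
    have "finite {n. y n \<noteq> x n}" using fin by (simp only: eq_commute[of "y _"])
    then show "x \<in> clopen_group F" if "y \<in> clopen_group F" using step[OF that] by blast
  qed
qed

text \<open>A point \<open>z\<close> of the coding space consists of functions \<open>h\<^sub>q\<^sub>j\<close> with values in
  \<open>\<nat> / (Suc M + n)\<close> at \<open>n\<close>, a modulus witnessing that \<open>h\<^sub>q\<^sub>j\<close> is slowly oscillating with respect
  to \<open>D j\<close>, and a characteristic function that is determined by the \<open>h\<^sub>q\<^sub>j\<close> with \<open>q, j < M\<close> up to
  precision \<open>1 / Suc M\<close>. Letting the denominators grow with \<open>n\<close> makes every bounded function
  asymptotic to one with such values, while each value is coded by a single number.\<close>

type_synonym coding_index = "(nat \<times> nat \<times> nat) + (nat \<times> nat \<times> nat \<times> nat) + nat"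

definition coded :: "nat \<Rightarrow> (coding_index \<Rightarrow> nat) \<Rightarrow> nat \<Rightarrow> nat \<Rightarrow> nat \<Rightarrow> real" where
  "coded M z q j n = real (z (Inl (q, j, n))) / real (Suc M + n)"

definition codes :: "(nat \<Rightarrow> nat \<Rightarrow> nat \<Rightarrow> real) \<Rightarrow> nat \<Rightarrow> (coding_index \<Rightarrow> nat) set" where
  "codes D M = {z.
     (\<forall>q j n. coded M z q j n \<le> 2 * real M) \<and>
     (\<forall>q j r s n m. z (Inr (Inl (q, j, r, s))) < Suc n \<longrightarrow> D j n m < real r \<longrightarrow>
        \<bar>coded M z q j n - coded M z q j m\<bar> \<le> 1 / real (Suc s)) \<and>
     (\<forall>n m. (\<forall>q\<in>{..<M}. \<forall>j\<in>{..<M}. \<bar>coded M z q j n - coded M z q j m\<bar> < 1 / real (Suc M)) \<longrightarrow>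
        (z (Inr (Inr n)) \<noteq> 0) = (z (Inr (Inr m)) \<noteq> 0))}"

lemma continuous_on_discrete_coordinate:
  fixes g :: "nat \<Rightarrow> 'b::topological_space"
  shows "continuous_on UNIV (\<lambda>z :: 'i \<Rightarrow> nat. g (z i))"
  by (rule continuous_on_compose2[OF Topological_Spaces.continuous_on_discrete continuous_on_product_coordinates]) auto

text \<open>For fixed parameters each clause concerns finitely many coordinates. Premises are strict
  inequalities or constants, hence open, and conclusions are closed.\<close>

lemma closed_codes: "closed (codes D M)"
proof -
  have cont: "continuous_on UNIV (\<lambda>z. coded M z q j n)" for q j n
    unfolding coded_def by (rule continuous_on_discrete_coordinate)
  have "open {z. \<forall>q\<in>{..<M}. \<forall>j\<in>{..<M}. \<bar>coded M z q j n - coded M z q j m\<bar> < 1 / real (Suc M)}" for n m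
  proof -
    have "open (\<Inter>q\<in>{..<M}. \<Inter>j\<in>{..<M}. {z. \<bar>coded M z q j n - coded M z q j m\<bar> < 1 / real (Suc M)})"
      by (intro open_INT ballI open_Collect_less continuous_intros cont) auto
    moreover have "(\<Inter>q\<in>{..<M}. \<Inter>j\<in>{..<M}. {z. \<bar>coded M z q j n - coded M z q j m\<bar> < 1 / real (Suc M)}) =
      {z. \<forall>q\<in>{..<M}. \<forall>j\<in>{..<M}. \<bar>coded M z q j n - coded M z q j m\<bar> < 1 / real (Suc M)}" by auto
    ultimately show ?thesis by simp
  qed
  then show ?thesis
    unfolding codes_def
    by (intro closed_Collect_conj closed_Collect_all closed_Collect_imp closed_Collect_le
        closed_Collect_eq open_Collect_less open_Collect_const continuous_intros cont
        continuous_on_discrete_coordinate[where g = "\<lambda>k. k"]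
        continuous_on_discrete_coordinate[where g = "\<lambda>k. k \<noteq> 0"])
qed

definition coded_set :: "(coding_index \<Rightarrow> nat) \<Rightarrow> nat \<Rightarrow> bool" where
  "coded_set z n \<longleftrightarrow> z (Inr (Inr n)) \<noteq> 0"

lemma continuous_coded_set: "continuous_on UNIV coded_set"
  unfolding coded_set_def[abs_def]
  by (intro continuous_on_coordinatewise_then_product continuous_on_discrete_coordinate[where g = "\<lambda>k. k \<noteq> 0"])

lemma coded_in_higson_ring:
  assumes z: "z \<in> codes D M" and d: "D j \<in> PM"
  shows "coded M z q j \<in> higson_ring (D j)"
  unfolding higson_ring_iff[OF d]
proof (intro conjI allI impI)
  have "0 \<le> coded M z q j n" "coded M z q j n \<le> 2 * real M" for n
    using z by (auto simp: codes_def coded_def)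
  then show "bounded (range (coded M z q j))" by (intro boundedI[of _ "2 * real M"]) auto
  fix r \<epsilon> :: real assume "r > 0" and \<epsilon>: "\<epsilon> > 0"
  \<comment> \<open>Moduli are coded only for integer radii and precisions \<open>1 / Suc s\<close>,
    so \<open>r\<close> is rounded up and \<epsilon> down.\<close>
  obtain r' where r': "r \<le> real r'" using real_arch_simple by blast
  obtain s where s: "1 / real (Suc s) < \<epsilon>"
    using reals_Archimedean[OF \<epsilon>] by (auto simp: inverse_eq_divide)
  have "\<bar>coded M z q j n - coded M z q j m\<bar> \<le> \<epsilon>"
    if "n \<ge> z (Inr (Inl (q, j, r', s)))" "D j n m < r" for n m
  proof -
    have "z (Inr (Inl (q, j, r', s))) < Suc n" "D j n m < real r'" using that r' by linarith+
    then have "\<bar>coded M z q j n - coded M z q j m\<bar> \<le> 1 / real (Suc s)"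
      using z unfolding codes_def mem_Collect_eq by blast
    with s show ?thesis by linarith
  qed
  then show "\<forall>\<^sub>F n in sequentially. \<forall>m. D j n m < r \<longrightarrow> \<bar>coded M z q j n - coded M z q j m\<bar> \<le> \<epsilon>"
    unfolding eventually_sequentially by blast
qed

lemma coded_set_in_clopen_group:
  assumes z: "z \<in> codes D M" and D: "range D \<subseteq> PM"
  shows "coded_set z \<in> clopen_group (range D)"
proof -
  define G where "G = (\<lambda>(q, j). coded M z q j) ` ({..<M} \<times> {..<M})"
  have "G \<subseteq> (\<Union>d\<in>range D. higson_ring d)"
  proof
    fix g assume "g \<in> G"
    then obtain q j where "g = coded M z q j" by (auto simp: G_def)
    moreover have "D j \<in> PM" using D by blast
    ultimately have "g \<in> higson_ring (D j)" using coded_in_higson_ring[OF z] by simp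
    then show "g \<in> (\<Union>d\<in>range D. higson_ring d)" by blast
  qed
  moreover have "coded_set z n = coded_set z m"
    if "\<forall>g\<in>G. \<bar>g n - g m\<bar> < 1 / real (Suc M)" for n m
  proof -
    have "\<forall>q\<in>{..<M}. \<forall>j\<in>{..<M}. \<bar>coded M z q j n - coded M z q j m\<bar> < 1 / real (Suc M)"
      using that by (auto simp: G_def)
    then show ?thesis using z unfolding codes_def coded_set_def mem_Collect_eq by blast
  qed
  moreover have "finite G" by (simp add: G_def)
  ultimately show ?thesis
    unfolding clopen_group_def mem_Collect_eq ind_in_uc_iff
    by (intro exI[of _ G] exI[of _ "1 / real (Suc M)"]) simp
qed

text \<open>The numerator of \<open>g n + M\<close> rounded down to the grid at \<open>n\<close>. If
  \<open>g\<close> is bounded by \<open>M\<close>, the shift makes this value nonnegative, so it can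
  be coded by a natural number.\<close>

definition grid_approx :: "nat \<Rightarrow> (nat \<Rightarrow> real) \<Rightarrow> nat \<Rightarrow> nat" where
  "grid_approx M g n = nat \<lfloor>(g n + real M) * real (Suc M + n)\<rfloor>"

lemma grid_approx:
  assumes "\<bar>g n\<bar> \<le> real M"
  shows "real (grid_approx M g n) / real (Suc M + n) \<le> g n + real M"
    and "g n + real M - real (grid_approx M g n) / real (Suc M + n) < 1 / real (Suc M + n)"
proof -
  let ?k = "real (Suc M + n)"
  have k: "?k > 0" by simp
  have "(g n + real M) * ?k \<ge> 0" using assms by simp
  then have "real (grid_approx M g n) \<le> (g n + real M) * ?k"
    "(g n + real M) * ?k < real (grid_approx M g n) + 1"
    unfolding grid_approx_def by linarith+
  then have "real (grid_approx M g n) / ?k \<le> g n + real M"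
    "g n + real M < (real (grid_approx M g n) + 1) / ?k"
    using k by (simp_all only: pos_divide_le_eq pos_less_divide_eq)
  then show "real (grid_approx M g n) / ?k \<le> g n + real M"
    "g n + real M - real (grid_approx M g n) / ?k < 1 / ?k"
    by (simp_all only: add_divide_distrib)
qed

text \<open>The grid gets finer, so the rounded function minus \<open>g\<close> converges to
  \<open>M\<close> and lies in the ring. Adding \<open>g\<close> back stays in the ring because
  \<open>{g, u}\<close> controls the sum.\<close>

lemma grid_approx_in_higson_ring:
  assumes d: "d \<in> PM" and g: "g \<in> higson_ring d" and bd: "\<And>n. \<bar>g n\<bar> \<le> real M"
  shows "(\<lambda>n. real (grid_approx M g n) / real (Suc M + n)) \<in> higson_ring d" (is "?h \<in> _")
proof -
  define u where "u n = ?h n - g n" for n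
  have "(\<lambda>n. u n - real M) \<longlonglongrightarrow> 0"
  proof (rule Lim_null_comparison)
    have "norm (u n - real M) \<le> 1 / real (Suc n)" for n
    proof -
      have "norm (u n - real M) \<le> 1 / real (Suc M + n)"
        using grid_approx[of g n M, OF bd] unfolding u_def real_norm_def by linarith
      also have "\<dots> \<le> 1 / real (Suc n)" by (intro divide_left_mono) auto
      finally show ?thesis .
    qed
    then show "\<forall>\<^sub>F n in sequentially. norm (u n - real M) \<le> 1 / real (Suc n)" by simp
    show "(\<lambda>n. 1 / real (Suc n)) \<longlonglongrightarrow> 0"
      using LIMSEQ_inverse_real_of_nat by (simp add: inverse_eq_divide)
  qed
  then have "u \<in> higson_ring d"
    using convergent_in_higson_ring[OF d] LIM_zero_cancel by blast
  with g have sub: "{g, u} \<subseteq> higson_ring d" by simp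
  have h: "?h n = g n + u n" for n by (simp add: u_def)
  have "?h \<in> uc {g, u}"
  proof (rule ucI)
    have "\<bar>?h n\<bar> \<le> 2 * real M" for n
      using grid_approx(1)[of g n M, OF bd] bd[of n] by simp
    then show "bounded (range ?h)" by (intro boundedI[of _ "2 * real M"]) auto
    fix \<epsilon> :: real assume "\<epsilon> > 0"
    moreover have "\<bar>?h n - ?h m\<bar> < \<epsilon>" if "\<forall>g\<in>{g, u}. \<bar>g n - g m\<bar> < \<epsilon> / 2" for n m
    proof -
      have "\<bar>g n - g m\<bar> < \<epsilon> / 2" "\<bar>u n - u m\<bar> < \<epsilon> / 2" using that by simp_all
      then show ?thesis unfolding h by linarith
    qed
    ultimately show "\<exists>G \<delta>. finite G \<and> G \<subseteq> {g, u} \<and> \<delta> > 0 \<and>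
        (\<forall>n m. (\<forall>g\<in>G. \<bar>g n - g m\<bar> < \<delta>) \<longrightarrow> \<bar>?h n - ?h m\<bar> < \<epsilon>)"
      by (intro exI[of _ "{g, u}"] exI[of _ "\<epsilon> / 2"]) simp
  qed
  also have "uc {g, u} \<subseteq> uc (higson_ring d)" by (rule uc_mono[OF sub])
  also have "\<dots> \<subseteq> higson_ring d" by (rule uc_higson_ring[OF d])
  finally show ?thesis .
qed

text \<open>One \<open>M\<close> can bound the finitely many controlling functions, exceed their
  indices and be fine enough for \<delta>. Rounding these functions and choosing moduli for them
  gives a code.\<close>

lemma clopen_group_coded:
  assumes x: "x \<in> clopen_group (range D)" and D: "range D \<subseteq> PM"
  shows "\<exists>M. x \<in> coded_set ` codes D M"
proof -
  obtain G \<delta> where G: "finite G" "G \<subseteq> (\<Union>d\<in>range D. higson_ring d)" "\<delta> > 0"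
    "\<forall>n m. (\<forall>g\<in>G. \<bar>g n - g m\<bar> < \<delta>) \<longrightarrow> x n = x m"
    using x unfolding clopen_group_def mem_Collect_eq ind_in_uc_iff by blast
  define \<gamma> where "\<gamma> q j = (let g = from_nat_into G q in if g \<in> G \<and> g \<in> higson_ring (D j) then g else (\<lambda>_. 0))"
    for q j
  have \<gamma>_cases: "\<gamma> q j = (\<lambda>_. 0) \<or> \<gamma> q j \<in> G" for q j
    by (auto simp: \<gamma>_def Let_def)
  have \<gamma>: "\<gamma> q j \<in> higson_ring (D j)" for q j
    using convergent_in_higson_ring[of "D j" "\<lambda>_. 0"] D by (auto simp: \<gamma>_def Let_def)
  have "\<exists>q j. \<gamma> q j = g" if g: "g \<in> G" for g
  proof -
    obtain q where "from_nat_into G q = g"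
      using from_nat_into_surj[OF countable_finite[OF G(1)] g] by blast
    moreover obtain j where "g \<in> higson_ring (D j)" using g G(2) by blast
    ultimately have "\<gamma> q j = g" using g by (simp add: \<gamma>_def)
    then show ?thesis by blast
  qed
  then obtain Q J where QJ: "\<And>g. g \<in> G \<Longrightarrow> \<gamma> (Q g) (J g) = g" by metis
  have "\<forall>\<^sub>F M in sequentially. \<forall>g\<in>G. (\<forall>n. \<bar>g n\<bar> \<le> real M) \<and> Q g < M \<and> J g < M"
  proof (rule eventually_ball_finite[OF G(1)], rule ballI)
    fix g assume "g \<in> G"
    then have "bounded (range g)" using G(2) higson_ring_bounded by blast
    then obtain B where B: "\<And>n. \<bar>g n\<bar> \<le> B" by (auto simp: bounded_iff)
    obtain b where "B \<le> real b" using real_arch_simple by blast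
    then show "\<forall>\<^sub>F M in sequentially. (\<forall>n. \<bar>g n\<bar> \<le> real M) \<and> Q g < M \<and> J g < M"
      using B by (intro eventually_conj eventually_gt_at_top
          eventually_mono[OF eventually_ge_at_top[of b]]) (meson of_nat_mono order_trans)
  qed
  moreover obtain k where k: "3 / \<delta> \<le> real k" using real_arch_simple by blast
  ultimately have "\<forall>\<^sub>F M in sequentially. M \<ge> k \<and> (\<forall>g\<in>G. (\<forall>n. \<bar>g n\<bar> \<le> real M) \<and> Q g < M \<and> J g < M)"
    by (intro eventually_conj eventually_ge_at_top)
  then obtain M where M: "M \<ge> k" "\<forall>g\<in>G. (\<forall>n. \<bar>g n\<bar> \<le> real M) \<and> Q g < M \<and> J g < M"
    using eventually_happens' sequentially_bot by blast
  have "3 / \<delta> \<le> real (Suc M)" using k M(1) by linarith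
  \<comment> \<open>One third allows for the coded difference, the other two for the rounding errors
    at \<open>n\<close> and \<open>m\<close>.\<close>
  then have \<delta>: "3 * (1 / real (Suc M)) \<le> \<delta>" using G(3) by (simp add: field_simps)
  have bd: "\<bar>\<gamma> q j n\<bar> \<le> real M" for q j n
    using \<gamma>_cases[of q j] M(2) by auto
  define h where "h q j n = real (grid_approx M (\<gamma> q j) n) / real (Suc M + n)" for q j n
  have "h q j \<in> higson_ring (D j)" for q j
    unfolding h_def using grid_approx_in_higson_ring[OF _ \<gamma> bd] D by blast
  then have ex: "\<exists>N. \<forall>n\<ge>N. \<forall>m. D j n m < real r \<longrightarrow> \<bar>h q j n - h q j m\<bar> \<le> 1 / real (Suc s)" for q j r s
  proof (cases "r = 0")
    \<comment> \<open>Slow oscillation speaks only of positive radii; for \<open>r = 0\<close> the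
      premise fails since distances are nonnegative.\<close>
    case True
    interpret Metric_space UNIV "D j" using D by (auto simp: PM_def)
    have "\<not> D j n m < 0" for n m using nonneg by (simp add: not_less)
    then show ?thesis using True by simp
  next
    case False
    have "D j \<in> PM" using D by blast
    from \<open>h q j \<in> _\<close>[unfolded higson_ring_iff[OF this]] False show ?thesis
      unfolding eventually_sequentially by simp
  qed
  define N where "N q j r s =
      (SOME N. \<forall>n\<ge>N. \<forall>m. D j n m < real r \<longrightarrow> \<bar>h q j n - h q j m\<bar> \<le> 1 / real (Suc s))" for q j r s
  have N: "\<forall>n\<ge>N q j r s. \<forall>m. D j n m < real r \<longrightarrow> \<bar>h q j n - h q j m\<bar> \<le> 1 / real (Suc s)" for q j r s
    unfolding N_def by (rule someI_ex[OF ex])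
  define z where "z = case_sum (\<lambda>(q, j, n). grid_approx M (\<gamma> q j) n)
      (case_sum (\<lambda>(q, j, r, s). N q j r s) (\<lambda>n. of_bool (x n)))"
  have coded: "coded M z q j = h q j" for q j
    by (simp add: coded_def h_def z_def fun_eq_iff)
  have "h q j n \<le> 2 * real M" for q j n
    using grid_approx(1)[of "\<gamma> q j" n M, OF bd] bd[of q j n] unfolding h_def by linarith
  moreover have "x n = x m" if *: "\<forall>q\<in>{..<M}. \<forall>j\<in>{..<M}. \<bar>h q j n - h q j m\<bar> < 1 / real (Suc M)" for n m
  proof -
    have "\<bar>g n - g m\<bar> < \<delta>" if "g \<in> G" for g
    proof -
      define q j where "q = Q g" and "j = J g"
      have g: "\<gamma> q j = g" and qj: "q < M" "j < M" using QJ M(2) that by (auto simp: q_def j_def)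
      have near: "h q j k \<le> g k + real M" "g k + real M - h q j k < 1 / real (Suc M)" for k
      proof -
        show "h q j k \<le> g k + real M"
          using grid_approx(1)[of "\<gamma> q j" k M, OF bd] by (simp add: h_def g)
        have "g k + real M - h q j k < 1 / real (Suc M + k)"
          using grid_approx(2)[of "\<gamma> q j" k M, OF bd] by (simp add: h_def g)
        also have "\<dots> \<le> 1 / real (Suc M)" by (intro divide_left_mono) auto
        finally show "g k + real M - h q j k < 1 / real (Suc M)" .
      qed
      have "\<bar>h q j n - h q j m\<bar> < 1 / real (Suc M)" using * qj by simp
      then show ?thesis using near[of n] near[of m] \<delta> by linarith
    qed
    then show ?thesis using G(4) by blast
  qed
  ultimately have "z \<in> codes D M"
    unfolding codes_def coded mem_Collect_eq
  proof (intro conjI allI impI)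
    fix q j r s n m assume "z (Inr (Inl (q, j, r, s))) < Suc n" "D j n m < real r"
    then show "\<bar>h q j n - h q j m\<bar> \<le> 1 / real (Suc s)"
      using N[of q j r s] by (simp add: z_def)
  qed (simp_all add: z_def)
  moreover have "coded_set z = x" by (simp add: coded_set_def z_def fun_eq_iff)
  ultimately show ?thesis by blast
qed

lemma analytic_clopen_group:
  assumes "finite F" "F \<noteq> {}" "F \<subseteq> PM"
  shows "analytic (clopen_group F)"
proof -
  \<comment> \<open>An enumeration with repetitions, so that codes can index the metrics by all
    natural numbers.\<close>
  define D where "D = from_nat_into F"
  have F: "F = range D"
    using assms(1,2) by (simp add: D_def range_from_nat_into countable_finite)
  have "clopen_group F = (\<Union>M. coded_set ` codes D M)"
    using clopen_group_coded coded_set_in_clopen_group assms(3) unfolding F by blast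
  moreover have "analytic (\<Union>M. coded_set ` codes D M)"
    by (intro analytic_UN analytic_continuous_image_closed closed_codes continuous_coded_set)
  ultimately show ?thesis by simp
qed

section \<open>The comparison of the two cardinals\<close>

theorem theorem6p9:
  shows "cov_\<A> \<le>\<^sub>\<infinity> hp"
proof -
  define \<D> where "\<D> = {D. D \<subseteq> PM' \<and> higson_FIP D \<and> stone_cech \<simeq>\<^sub>c cpn_sup (higson ` D)}"
  define \<C> where "\<C> = {\<A>'. \<A>' \<subseteq> \<A> \<and> \<Union>\<A>' = UNIV}"
  show ?thesis
  proof (cases "\<D> = {}")
    case True
    then have "hp = Infinity" by (simp add: hp_def \<D>_def min_card_def)
    then show ?thesis by (cases cov_\<A>) simp_all
  next
    case False
    then obtain D where D: "D \<in> \<D>" and "min_card \<D> = Cardinal |D|"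
      by (rule min_card_attained)
    then have hp: "hp = Cardinal |D|" by (simp add: hp_def \<D>_def)
    have PM: "D \<subseteq> PM" and FIP: "higson_FIP D" and sup: "stone_cech \<simeq>\<^sub>c cpn_sup (higson ` D)"
      using D by (auto simp: \<D>_def PM'_def)
    \<comment> \<open>A finite \<open>D\<close> would violate the Higson-FIP with
      \<open>F = D\<close>.\<close>
    have inf: "infinite D" using FIP sup by (auto simp: higson_FIP_def)
    define \<B> where "\<B> = clopen_group ` (Fpow D - {{}})"
    have "\<B> \<subseteq> \<A>"
    proof
      fix H assume "H \<in> \<B>"
      then obtain F where F: "F \<subseteq> D" "finite F" "F \<noteq> {}" and H: "H = clopen_group F"
        by (auto simp: \<B>_def Fpow_def)
      have FPM: "F \<subseteq> PM" using F(1) PM by blast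
      have "H \<noteq> UNIV"
        using higson_sup[OF F(3) FPM] FIP F unfolding higson_FIP_def H by blast
      then show "H \<in> \<A>"
        using subgroup_clopen_group analytic_clopen_group[OF F(2,3) FPM]
          clopen_group_finite_modifications[OF F(3) FPM]
        by (simp add: \<A>_def H)
    qed
    moreover have "\<Union>\<B> = UNIV"
    proof (intro equalityI subset_UNIV subsetI)
      fix x :: "nat \<Rightarrow> bool"
      have "D \<noteq> {}" using inf by auto
      from higson_sup[OF this PM] sup have "x \<in> clopen_group D" by simp
      then obtain G \<delta> where G: "finite G" "G \<subseteq> (\<Union>d\<in>D. higson_ring d)" "\<delta> > 0"
        "\<forall>n m. (\<forall>g\<in>G. \<bar>g n - g m\<bar> < \<delta>) \<longrightarrow> x n = x m"
        unfolding clopen_group_def mem_Collect_eq ind_in_uc_iff by blast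
      have "\<forall>g\<in>G. \<exists>d\<in>D. g \<in> higson_ring d" using G(2) by blast
      then obtain \<phi> where \<phi>: "\<And>g. g \<in> G \<Longrightarrow> \<phi> g \<in> D \<and> g \<in> higson_ring (\<phi> g)" by metis
      obtain d where d: "d \<in> D" using \<open>D \<noteq> {}\<close> by blast
      \<comment> \<open>The extra metric keeps \<open>F\<close> nonempty when \<open>G\<close> is
        empty, which happens only for constant \<open>x\<close>.\<close>
      define F where "F = insert d (\<phi> ` G)"
      have "G \<subseteq> (\<Union>d\<in>F. higson_ring d)" using \<phi> by (auto simp: F_def)
      with G have "x \<in> clopen_group F"
        unfolding clopen_group_def mem_Collect_eq ind_in_uc_iff by blast
      moreover have "F \<in> Fpow D - {{}}" using G(1) d \<phi> by (auto simp: F_def Fpow_def)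
      ultimately show "x \<in> \<Union>\<B>" unfolding \<B>_def by blast
    qed
    ultimately have \<B>: "\<B> \<in> \<C>" by (simp add: \<C>_def)
    then have "\<C> \<noteq> {}" by blast
    then obtain \<A>' where "min_card \<C> = Cardinal |\<A>'|" and least: "\<forall>\<B>\<in>\<C>. |\<A>'| \<le>o |\<B>|"
      by (rule min_card_attained)
    then have cov: "cov_\<A> = Cardinal |\<A>'|" by (simp add: cov_\<A>_def \<C>_def)
    have "|\<A>'| \<le>o |\<B>|" by (rule bspec[OF least \<B>])
    also have "|\<B>| \<le>o |Fpow D|"
      unfolding \<B>_def by (rule ordLeq_transitive[OF card_of_image card_of_mono1]) auto
    also have "|Fpow D| \<le>o |D|" by (rule card_of_Fpow_ordLeq_infinite[OF inf])
    finally show ?thesis by (simp add: cov hp)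
  qed
qed

end
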